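(* Let $R$ be a commutative noetherian ring with identity and let $C$ be an ideal of $R$ that is semidualizing as an $R$-module. Let $S$ be either of the following rings: (a) the amalgamated duplication $S=R\bowtie C$; (b) the pseudocanonical cover $S=S(h)$ of $R$ via $h$, where $h\in R$ is a square in $R$, i.e. $h=r_0^2$ for some $r_0\in R$. Then there exist ring homomorphisms $f\colon R\to S$ and $g\colon S\to R$ with $g\circ f=\operatorname{id}_R$ such that, regarding $S$ as an $R$-module via $f$, (i) $C\cong\operatorname{Ker} g$ as $R$-modules, (ii) $\operatorname{Hom}_R(S,C)\cong S$ as $S$-modules, and (iii) $\operatorname{Ext}^i_R(S,C)=0$ for all $i\geq 1$.
   Context: A finitely generated $R$-module $C$ is semidualizing if $R\cong\operatorname{Hom}_R(C,C)$ and $\operatorname{Ext}^i_R(C,C)=0$ for all $i\geq 1$. For an ideal $C$ of $R$, the amalgamated duplication $R\bowtie C$ of $R$ along $C$ is the additive group $R\oplus C$ with multiplication $(r,c)(r',c')=(rr',\,rc'+r'c+cc')$; it is a commutative ring with identity $(1_R,0)$. For an ideal $C$ of $R$ and $h\in R$, the pseudocanonical cover $S(h)$ of $R$ via $h$ is the additive group $R\oplus C$ with multiplication $(r,c)(r',c')=(rr'+cc'h,\,rc'+r'c)$; it is a commutative ring with identity $(1_R,0)$. The $S$-module structure on $\operatorname{Hom}_R(S,C)$ is $(s\varphi)(t)=\varphi(st)$. *)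

theory Defs
  imports "HOL-Algebra.Module" "HOL-Algebra.Ring_Divisibility"
begin

section \<open>Modules and their homomorphisms\<close>

text \<open>
  The library record of a module extends that of a ring, so module records carry
  two fields \<open>mult\<close> and \<open>one\<close> that no module notion looks at. They are set to
  \<open>undefined\<close> where no multiplication is available.
\<close>

definition mod_hom ::
  "('r, 'a) ring_scheme \<Rightarrow> ('r, 'm, 'b) module_scheme \<Rightarrow> ('r, 'n, 'c) module_scheme \<Rightarrow> ('m \<Rightarrow> 'n) set"
  where "mod_hom R M N = {h \<in> carrier M \<rightarrow> carrier N.
    (\<forall>x\<in>carrier M. \<forall>y\<in>carrier M. h (x \<oplus>\<^bsub>M\<^esub> y) = h x \<oplus>\<^bsub>N\<^esub> h y) \<and>
    (\<forall>a\<in>carrier R. \<forall>x\<in>carrier M. h (a \<odot>\<^bsub>M\<^esub> x) = a \<odot>\<^bsub>N\<^esub> h x)}"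

definition mod_isomorphic ::
  "('r, 'a) ring_scheme \<Rightarrow> ('r, 'm, 'b) module_scheme \<Rightarrow> ('r, 'n, 'c) module_scheme \<Rightarrow> bool"
  where "mod_isomorphic R M N \<longleftrightarrow> (\<exists>h\<in>mod_hom R M N. bij_betw h (carrier M) (carrier N))"

definition zero_module :: "('r, 'm, 'b) module_scheme \<Rightarrow> bool"
  where "zero_module M \<longleftrightarrow> carrier M = {\<zero>\<^bsub>M\<^esub>}"

definition fin_gen_module :: "('r, 'a) ring_scheme \<Rightarrow> ('r, 'm, 'b) module_scheme \<Rightarrow> bool"
  where "fin_gen_module R M \<longleftrightarrow> (\<exists>A. finite A \<and> A \<subseteq> carrier M \<and>
    (\<forall>H. submodule H R M \<longrightarrow> A \<subseteq> H \<longrightarrow> H = carrier M))"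

definition ring_module :: "('r, 'a) ring_scheme \<Rightarrow> ('r, 'r) module"
  where "ring_module R = \<lparr>carrier = carrier R, monoid.mult = monoid.mult R, one = one R,
    zero = zero R, add = add R, smult = monoid.mult R\<rparr>"

definition ideal_module :: "('r, 'a) ring_scheme \<Rightarrow> 'r set \<Rightarrow> ('r, 'r) module"
  where "ideal_module R I = (ring_module R)\<lparr>carrier := I\<rparr>"

text \<open>The ring \<open>S\<close> as a module over the domain of the ring homomorphism \<open>f\<close> into \<open>S\<close>:\<close>

definition module_via :: "('s, 'a) ring_scheme \<Rightarrow> ('r \<Rightarrow> 's) \<Rightarrow> ('r, 's) module"
  where "module_via S f = \<lparr>carrier = carrier S, monoid.mult = monoid.mult S, one = one S,
    zero = zero S, add = add S, smult = (\<lambda>a s. f a \<otimes>\<^bsub>S\<^esub> s)\<rparr>"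

text \<open>Homomorphisms are made extensional, so that equal maps are equal elements of Hom.\<close>

definition Hom_module ::
  "('r, 'a) ring_scheme \<Rightarrow> ('r, 'm, 'b) module_scheme \<Rightarrow> ('r, 'n, 'c) module_scheme \<Rightarrow> ('r, 'm \<Rightarrow> 'n) module"
  where "Hom_module R M N = \<lparr>carrier = mod_hom R M N \<inter> extensional (carrier M),
    monoid.mult = (\<lambda>_ _. undefined), one = undefined,
    zero = (\<lambda>x\<in>carrier M. \<zero>\<^bsub>N\<^esub>),
    add = (\<lambda>\<phi> \<psi>. \<lambda>x\<in>carrier M. \<phi> x \<oplus>\<^bsub>N\<^esub> \<psi> x),
    smult = (\<lambda>a \<phi>. \<lambda>x\<in>carrier M. a \<odot>\<^bsub>N\<^esub> \<phi> x)\<rparr>"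

text \<open>\<open>Hom\<^sub>R(S, N)\<close> as an \<open>S\<close>-module, where \<open>S\<close> is an \<open>R\<close>-module via \<open>f\<close>:\<close>

definition coinduced_module ::
  "('r, 'a) ring_scheme \<Rightarrow> ('s, 'b) ring_scheme \<Rightarrow> ('r \<Rightarrow> 's) \<Rightarrow> ('r, 'n, 'c) module_scheme \<Rightarrow> ('s, 's \<Rightarrow> 'n) module"
  where "coinduced_module R S f N =
    (let H = Hom_module R (module_via S f) N in
     \<lparr>carrier = carrier H, monoid.mult = monoid.mult H, one = one H, zero = zero H, add = add H,
      smult = (\<lambda>s \<phi>. \<lambda>t\<in>carrier S. \<phi> (s \<otimes>\<^bsub>S\<^esub> t))\<rparr>)"

definition quotient_module :: "('r, 'm, 'b) module_scheme \<Rightarrow> 'm set \<Rightarrow> ('r, 'm set) module"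
  where "quotient_module M K = \<lparr>carrier = a_rcosets\<^bsub>M\<^esub> K,
    monoid.mult = (\<lambda>_ _. undefined), one = undefined,
    zero = K, add = set_add M,
    smult = (\<lambda>a X. \<Union>x\<in>X. K +>\<^bsub>M\<^esub> (a \<odot>\<^bsub>M\<^esub> x))\<rparr>"


section \<open>Free resolutions and Ext\<close>

text \<open>The free module on a set \<open>X\<close>: finitely supported functions from \<open>X\<close> to \<open>R\<close>.\<close>

definition free_module :: "('r, 'a) ring_scheme \<Rightarrow> 'x set \<Rightarrow> ('r, 'x \<Rightarrow> 'r) module"
  where "free_module R X = \<lparr>
    carrier = {v. (\<forall>x\<in>X. v x \<in> carrier R) \<and> (\<forall>x. x \<notin> X \<longrightarrow> v x = \<zero>\<^bsub>R\<^esub>) \<and> finite {x. v x \<noteq> \<zero>\<^bsub>R\<^esub>}},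
    monoid.mult = (\<lambda>_ _. undefined), one = undefined,
    zero = (\<lambda>_. \<zero>\<^bsub>R\<^esub>),
    add = (\<lambda>v w x. v x \<oplus>\<^bsub>R\<^esub> w x),
    smult = (\<lambda>a v x. a \<otimes>\<^bsub>R\<^esub> v x)\<rparr>"

text \<open>
  Exactness of \<open>\<dots> \<rightarrow> F\<^sub>2 \<rightarrow> F\<^sub>1 \<rightarrow> F\<^sub>0 \<rightarrow> M \<rightarrow> 0\<close>, where \<open>F\<^sub>n\<close> is free on \<open>X n\<close>, the last map
  is \<open>e\<close>, and \<open>d n\<close> goes from \<open>F\<^sub>n\<^sub>+\<^sub>1\<close> to \<open>F\<^sub>n\<close>.
\<close>

definition free_resolution ::
  "('r, 'a) ring_scheme \<Rightarrow> ('r, 'm, 'b) module_scheme \<Rightarrow> (nat \<Rightarrow> 'x set) \<Rightarrow>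
    (('x \<Rightarrow> 'r) \<Rightarrow> 'm) \<Rightarrow> (nat \<Rightarrow> ('x \<Rightarrow> 'r) \<Rightarrow> ('x \<Rightarrow> 'r)) \<Rightarrow> bool"
  where "free_resolution R M X e d \<longleftrightarrow>
    (let F = (\<lambda>n. free_module R (X n)) in
      e \<in> mod_hom R (F 0) M \<and>
      (\<forall>n. d n \<in> mod_hom R (F (Suc n)) (F n)) \<and>
      e ` carrier (F 0) = carrier M \<and>
      d 0 ` carrier (F 1) = a_kernel (F 0) M e \<and>
      (\<forall>n. d (Suc n) ` carrier (F (Suc (Suc n))) = a_kernel (F (Suc n)) (F n) (d n)))"

text \<open>
  Cohomology of the complex \<open>Hom\<^sub>R(F\<^sub>0, N) \<rightarrow> Hom\<^sub>R(F\<^sub>1, N) \<rightarrow> \<dots>\<close>, whose maps are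
  precomposition with \<open>d\<close>.
\<close>

definition hom_cocycles ::
  "('r, 'a) ring_scheme \<Rightarrow> ('r, 'n, 'c) module_scheme \<Rightarrow> (nat \<Rightarrow> 'x set) \<Rightarrow>
    (nat \<Rightarrow> ('x \<Rightarrow> 'r) \<Rightarrow> ('x \<Rightarrow> 'r)) \<Rightarrow> nat \<Rightarrow> (('x \<Rightarrow> 'r) \<Rightarrow> 'n) set"
  where "hom_cocycles R N X d n = {\<phi> \<in> carrier (Hom_module R (free_module R (X n)) N).
    compose (carrier (free_module R (X (Suc n)))) \<phi> (d n) =
      \<zero>\<^bsub>Hom_module R (free_module R (X (Suc n))) N\<^esub>}"

fun hom_coboundaries ::
  "('r, 'a) ring_scheme \<Rightarrow> ('r, 'n, 'c) module_scheme \<Rightarrow> (nat \<Rightarrow> 'x set) \<Rightarrow>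
    (nat \<Rightarrow> ('x \<Rightarrow> 'r) \<Rightarrow> ('x \<Rightarrow> 'r)) \<Rightarrow> nat \<Rightarrow> (('x \<Rightarrow> 'r) \<Rightarrow> 'n) set"
  where
    "hom_coboundaries R N X d 0 = {\<zero>\<^bsub>Hom_module R (free_module R (X 0)) N\<^esub>}"
  | "hom_coboundaries R N X d (Suc n) =
      (\<lambda>\<phi>. compose (carrier (free_module R (X (Suc n)))) \<phi> (d n)) `
        carrier (Hom_module R (free_module R (X n)) N)"

definition hom_cohomology ::
  "('r, 'a) ring_scheme \<Rightarrow> ('r, 'n, 'c) module_scheme \<Rightarrow> (nat \<Rightarrow> 'x set) \<Rightarrow>
    (nat \<Rightarrow> ('x \<Rightarrow> 'r) \<Rightarrow> ('x \<Rightarrow> 'r)) \<Rightarrow> nat \<Rightarrow> ('r, (('x \<Rightarrow> 'r) \<Rightarrow> 'n) set) module"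
  where "hom_cohomology R N X d n = quotient_module
    ((Hom_module R (free_module R (X n)) N)\<lparr>carrier := hom_cocycles R N X d n\<rparr>)
    (hom_coboundaries R N X d n)"

text \<open>
  \<open>Ext\<close> is computed from a chosen free resolution. The basis elements of the chosen
  resolution are taken from the following type, which is large enough for every
  \<open>R\<close>-module with elements in \<open>'m\<close> to have a free resolution
  (lemma \<open>free_resolution_exists\<close> below): basis elements of \<open>F\<^sub>0\<close> name elements of the
  module, and those of \<open>F\<^sub>n\<^sub>+\<^sub>1\<close> name linear combinations of basis elements of \<open>F\<^sub>n\<close>.
\<close>

datatype ('r, 'm) res_index = Elt 'm | Comb "('r \<times> ('r, 'm) res_index) list"

definition Ext ::
  "('r, 'a) ring_scheme \<Rightarrow> ('r, 'm, 'b) module_scheme \<Rightarrow> ('r, 'n, 'c) module_scheme \<Rightarrow> nat \<Rightarrow>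
    ('r, ((('r, 'm) res_index \<Rightarrow> 'r) \<Rightarrow> 'n) set) module"
  where "Ext R M N i =
    (case (SOME (X, e, d). free_resolution R M X e d) of
      (X, e, d) \<Rightarrow> hom_cohomology R N X d i)"


section \<open>Semidualizing modules\<close>

definition semidualizing :: "('r, 'a) ring_scheme \<Rightarrow> ('r, 'm, 'b) module_scheme \<Rightarrow> bool"
  where "semidualizing R C \<longleftrightarrow>
    module R C \<and> fin_gen_module R C \<and>
    mod_isomorphic R (ring_module R) (Hom_module R C C) \<and>
    (\<forall>i\<ge>1. zero_module (Ext R C C i))"


section \<open>Amalgamated duplication and pseudocanonical cover\<close>

definition amalgamated_duplication :: "('r, 'a) ring_scheme \<Rightarrow> 'r set \<Rightarrow> ('r \<times> 'r) ring"
  where "amalgamated_duplication R C = \<lparr>carrier = carrier R \<times> C,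
    monoid.mult = (\<lambda>(r, c) (r', c'). (r \<otimes>\<^bsub>R\<^esub> r', r \<otimes>\<^bsub>R\<^esub> c' \<oplus>\<^bsub>R\<^esub> r' \<otimes>\<^bsub>R\<^esub> c \<oplus>\<^bsub>R\<^esub> c \<otimes>\<^bsub>R\<^esub> c')),
    one = (\<one>\<^bsub>R\<^esub>, \<zero>\<^bsub>R\<^esub>), zero = (\<zero>\<^bsub>R\<^esub>, \<zero>\<^bsub>R\<^esub>),
    add = (\<lambda>(r, c) (r', c'). (r \<oplus>\<^bsub>R\<^esub> r', c \<oplus>\<^bsub>R\<^esub> c'))\<rparr>"

definition pseudocanonical_cover :: "('r, 'a) ring_scheme \<Rightarrow> 'r set \<Rightarrow> 'r \<Rightarrow> ('r \<times> 'r) ring"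
  where "pseudocanonical_cover R C h = \<lparr>carrier = carrier R \<times> C,
    monoid.mult = (\<lambda>(r, c) (r', c'). (r \<otimes>\<^bsub>R\<^esub> r' \<oplus>\<^bsub>R\<^esub> c \<otimes>\<^bsub>R\<^esub> c' \<otimes>\<^bsub>R\<^esub> h, r \<otimes>\<^bsub>R\<^esub> c' \<oplus>\<^bsub>R\<^esub> r' \<otimes>\<^bsub>R\<^esub> c)),
    one = (\<one>\<^bsub>R\<^esub>, \<zero>\<^bsub>R\<^esub>), zero = (\<zero>\<^bsub>R\<^esub>, \<zero>\<^bsub>R\<^esub>),
    add = (\<lambda>(r, c) (r', c'). (r \<oplus>\<^bsub>R\<^esub> r', c \<oplus>\<^bsub>R\<^esub> c'))\<rparr>"

section \<open>Well-definedness\<close>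

lemma cring_amalgamated_duplication:
  fixes R (structure)
  assumes "cring R" "ideal C R"
  shows "cring (amalgamated_duplication R C)" (is "cring ?S")
proof -
  interpret cring R by fact
  interpret C: ideal C R by fact
  have C [simp]: "c \<in> carrier R" if "c \<in> C" for c
    using that C.a_subset by auto
  note [simp] = C.a_closed C.I_l_closed C.I_r_closed
  have carrier: "carrier ?S = carrier R \<times> C"
    and add: "(a, b) \<oplus>\<^bsub>?S\<^esub> (a', b') = (a \<oplus> a', b \<oplus> b')"
    and mult: "(a, b) \<otimes>\<^bsub>?S\<^esub> (a', b') = (a \<otimes> a', a \<otimes> b' \<oplus> a' \<otimes> b \<oplus> b \<otimes> b')"
    and zero: "\<zero>\<^bsub>?S\<^esub> = (\<zero>, \<zero>)" and one: "\<one>\<^bsub>?S\<^esub> = (\<one>, \<zero>)" for a b a' b'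
    by (simp_all add: amalgamated_duplication_def)
  note defs = carrier add mult zero one
  show ?thesis
  proof (rule cringI)
    show "abelian_group ?S"
    proof (rule abelian_groupI)
      fix x assume "x \<in> carrier ?S"
      then obtain r c where x: "x = (r, c)" "r \<in> carrier R" "c \<in> C"
        by (auto simp: defs)
      then have "\<ominus> c \<in> C" by (simp add: C.a_inv_closed)
      with x show "\<exists>y\<in>carrier ?S. y \<oplus>\<^bsub>?S\<^esub> x = \<zero>\<^bsub>?S\<^esub>"
        by (intro bexI[of _ "(\<ominus> r, \<ominus> c)"]) (simp_all add: defs l_neg)
    qed (auto simp: defs a_ac)
    show "comm_monoid ?S"
    proof (rule comm_monoidI)
      fix x y z assume "x \<in> carrier ?S" "y \<in> carrier ?S" "z \<in> carrier ?S"
      then obtain r1 c1 r2 c2 r3 c3 where "x = (r1, c1)" "y = (r2, c2)" "z = (r3, c3)"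
        "r1 \<in> carrier R" "r2 \<in> carrier R" "r3 \<in> carrier R" "c1 \<in> C" "c2 \<in> C" "c3 \<in> C"
        by (auto simp: defs)
      then show "x \<otimes>\<^bsub>?S\<^esub> y \<otimes>\<^bsub>?S\<^esub> z = x \<otimes>\<^bsub>?S\<^esub> (y \<otimes>\<^bsub>?S\<^esub> z)"
        by (simp add: defs l_distr r_distr a_ac m_ac)
    qed (auto simp: defs a_ac m_ac)
    fix x y z assume "x \<in> carrier ?S" "y \<in> carrier ?S" "z \<in> carrier ?S"
    then show "(x \<oplus>\<^bsub>?S\<^esub> y) \<otimes>\<^bsub>?S\<^esub> z = x \<otimes>\<^bsub>?S\<^esub> z \<oplus>\<^bsub>?S\<^esub> y \<otimes>\<^bsub>?S\<^esub> z"
      by (auto simp: defs l_distr r_distr a_ac m_ac)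
  qed
qed

lemma cring_pseudocanonical_cover:
  fixes R (structure)
  assumes "cring R" "ideal C R" "h \<in> carrier R"
  shows "cring (pseudocanonical_cover R C h)" (is "cring ?S")
proof -
  interpret cring R by fact
  interpret C: ideal C R by fact
  have C [simp]: "c \<in> carrier R" if "c \<in> C" for c
    using that C.a_subset by auto
  note [simp] = C.a_closed C.I_l_closed C.I_r_closed assms(3)
  have carrier: "carrier ?S = carrier R \<times> C"
    and add: "(a, b) \<oplus>\<^bsub>?S\<^esub> (a', b') = (a \<oplus> a', b \<oplus> b')"
    and mult: "(a, b) \<otimes>\<^bsub>?S\<^esub> (a', b') = (a \<otimes> a' \<oplus> b \<otimes> b' \<otimes> h, a \<otimes> b' \<oplus> a' \<otimes> b)"
    and zero: "\<zero>\<^bsub>?S\<^esub> = (\<zero>, \<zero>)" and one: "\<one>\<^bsub>?S\<^esub> = (\<one>, \<zero>)" for a b a' b'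
    by (simp_all add: pseudocanonical_cover_def)
  note defs = carrier add mult zero one
  show ?thesis
  proof (rule cringI)
    show "abelian_group ?S"
    proof (rule abelian_groupI)
      fix x assume "x \<in> carrier ?S"
      then obtain r c where x: "x = (r, c)" "r \<in> carrier R" "c \<in> C"
        by (auto simp: defs)
      then have "\<ominus> c \<in> C" by (simp add: C.a_inv_closed)
      with x show "\<exists>y\<in>carrier ?S. y \<oplus>\<^bsub>?S\<^esub> x = \<zero>\<^bsub>?S\<^esub>"
        by (intro bexI[of _ "(\<ominus> r, \<ominus> c)"]) (simp_all add: defs l_neg)
    qed (auto simp: defs a_ac)
    show "comm_monoid ?S"
    proof (rule comm_monoidI)
      fix x y z assume "x \<in> carrier ?S" "y \<in> carrier ?S" "z \<in> carrier ?S"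
      then obtain r1 c1 r2 c2 r3 c3 where "x = (r1, c1)" "y = (r2, c2)" "z = (r3, c3)"
        "r1 \<in> carrier R" "r2 \<in> carrier R" "r3 \<in> carrier R" "c1 \<in> C" "c2 \<in> C" "c3 \<in> C"
        by (auto simp: defs)
      then show "x \<otimes>\<^bsub>?S\<^esub> y \<otimes>\<^bsub>?S\<^esub> z = x \<otimes>\<^bsub>?S\<^esub> (y \<otimes>\<^bsub>?S\<^esub> z)"
        by (simp add: defs l_distr r_distr a_ac m_ac)
    qed (auto simp: defs a_ac m_ac)
    fix x y z assume "x \<in> carrier ?S" "y \<in> carrier ?S" "z \<in> carrier ?S"
    then show "(x \<oplus>\<^bsub>?S\<^esub> y) \<otimes>\<^bsub>?S\<^esub> z = x \<otimes>\<^bsub>?S\<^esub> z \<oplus>\<^bsub>?S\<^esub> y \<otimes>\<^bsub>?S\<^esub> z"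
      by (auto simp: defs l_distr r_distr a_ac m_ac)
  qed
qed

lemma module_free_module:
  fixes R (structure) and X :: "'x set"
  assumes "cring R"
  shows "module R (free_module R X)"
proof -
  interpret cring R by fact
  have fin: "finite {x. f (v x) (w x) \<noteq> \<zero>}"
    if "finite {x. v x \<noteq> \<zero>}" "finite {x. w x \<noteq> \<zero>}" "f \<zero> \<zero> = \<zero>" for f and v w :: "'x \<Rightarrow> _"
  proof (rule finite_subset)
    show "{x. f (v x) (w x) \<noteq> \<zero>} \<subseteq> {x. v x \<noteq> \<zero>} \<union> {x. w x \<noteq> \<zero>}"
      using that(3) by auto
  qed (use that in simp)
  have cl: "v x \<in> carrier R" if "v \<in> carrier (free_module R X)" for v x
    using that by (cases "x \<in> X") (auto simp: free_module_def)
  have sub: "v \<in> carrier (free_module R X)"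
    if "\<And>x. x \<in> X \<Longrightarrow> v x \<in> carrier R" "\<And>x. x \<notin> X \<Longrightarrow> v x = \<zero>" "finite {x. v x \<noteq> \<zero>}" for v
    using that by (auto simp: free_module_def)
  have addc: "(\<lambda>x. v x \<oplus> w x) \<in> carrier (free_module R X)"
    if "v \<in> carrier (free_module R X)" "w \<in> carrier (free_module R X)" for v w
    using that fin[of v w "(\<oplus>)"] by (intro sub) (auto simp: free_module_def)
  have smc: "(\<lambda>x. a \<otimes> v x) \<in> carrier (free_module R X)"
    if "v \<in> carrier (free_module R X)" "a \<in> carrier R" for v a
    using that fin[of v v "\<lambda>p q. a \<otimes> p"] by (intro sub) (auto simp: free_module_def)
  have ops: "add (free_module R X) = (\<lambda>v w x. v x \<oplus> w x)"
    "smult (free_module R X) = (\<lambda>a v x. a \<otimes> v x)" "zero (free_module R X) = (\<lambda>_. \<zero>)"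
    by (auto simp: free_module_def)
  show ?thesis
  proof (intro moduleI abelian_groupI, goal_cases)
    case (7 v)
    have "(\<lambda>x. \<ominus> \<one> \<otimes> v x) \<in> carrier (free_module R X)"
      by (rule smc) (use 7 in auto)
    then show ?case
      by (rule bexI[rotated]) (auto simp: ops fun_eq_iff cl[OF 7] l_minus l_neg)
  next
    case 3
    show ?case by (auto simp: free_module_def)
  qed (auto simp: ops addc smc fun_eq_iff cl l_distr r_distr a_ac m_ac assms)
qed

text \<open>Every module is a quotient of a free module, with basis elements taken from any
  type into which the module can be coded.\<close>

lemma free_module_cover:
  fixes R (structure) and N (structure) and code :: "'m \<Rightarrow> 'x"
  assumes "module R N" and inj: "inj_on code (carrier N)"
  shows "\<exists>h\<in>mod_hom R (free_module R (code ` carrier N)) N.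
    h ` carrier (free_module R (code ` carrier N)) = carrier N"
proof -
  interpret module R N by fact
  define X where "X = code ` carrier N"
  define u where "u = inv_into (carrier N) code"
  define s where "s v = {x. v x \<noteq> \<zero>\<^bsub>R\<^esub>}" for v :: "'x \<Rightarrow> 'a"
  define h where "h v = (\<Oplus>\<^bsub>N\<^esub>x\<in>s v. v x \<odot>\<^bsub>N\<^esub> u x)" for v
  define F where "F = free_module R X"
  have u: "u x \<in> carrier N" if "x \<in> X" for x
    using that unfolding u_def X_def by (rule inv_into_into)
  have F: "v x \<in> carrier R" "s v \<subseteq> X" "finite (s v)" if "v \<in> carrier F" for v x
    using that by (cases "x \<in> X"; auto simp: F_def free_module_def s_def)+
  have h_eq: "h v = (\<Oplus>\<^bsub>N\<^esub>x\<in>A. v x \<odot>\<^bsub>N\<^esub> u x)"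
    if "v \<in> carrier F" "finite A" "s v \<subseteq> A" "A \<subseteq> X" for v A
    unfolding h_def
  proof (rule M.add.finprod_mono_neutral_cong_left)
    show "\<And>i. i \<in> A - s v \<Longrightarrow> v i \<odot>\<^bsub>N\<^esub> u i = \<zero>\<^bsub>N\<^esub>"
      using that u by (auto simp: s_def)
    show "(\<lambda>x. v x \<odot>\<^bsub>N\<^esub> u x) \<in> A \<rightarrow> carrier N"
      using that u F(1) by auto
  qed (use that in auto)
  interpret F: module R F
    unfolding F_def by (rule module_free_module) (rule R.is_cring)
  have ops: "add F = (\<lambda>v w x. v x \<oplus>\<^bsub>R\<^esub> w x)" "smult F = (\<lambda>a v x. a \<otimes>\<^bsub>R\<^esub> v x)"
    by (auto simp: F_def free_module_def)
  have closed: "(\<lambda>x. v x \<odot>\<^bsub>N\<^esub> u x) \<in> A \<rightarrow> carrier N" if "v \<in> carrier F" "A \<subseteq> X" for v A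
    using that u F(1) by auto
  have "h \<in> mod_hom R F N"
    unfolding mod_hom_def
  proof (intro CollectI conjI ballI funcsetI)
    fix v assume v: "v \<in> carrier F"
    show "h v \<in> carrier N"
      unfolding h_def by (rule M.finsum_closed) (rule closed[OF v F(2)[OF v]])
    fix w assume w: "w \<in> carrier F"
    define A where "A = s v \<union> s w"
    have A: "finite A" "A \<subseteq> X" "s v \<subseteq> A" "s w \<subseteq> A"
      using F(2,3)[OF v] F(2,3)[OF w] by (auto simp: A_def)
    have vw: "v \<oplus>\<^bsub>F\<^esub> w \<in> carrier F" using v w by simp
    have "s (v \<oplus>\<^bsub>F\<^esub> w) \<subseteq> A"
      by (auto simp: ops s_def A_def)
    then have "h (v \<oplus>\<^bsub>F\<^esub> w) = (\<Oplus>\<^bsub>N\<^esub>x\<in>A. (v x \<oplus>\<^bsub>R\<^esub> w x) \<odot>\<^bsub>N\<^esub> u x)"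
      using h_eq[OF vw] A by (simp add: ops)
    also have "\<dots> = (\<Oplus>\<^bsub>N\<^esub>x\<in>A. v x \<odot>\<^bsub>N\<^esub> u x \<oplus>\<^bsub>N\<^esub> w x \<odot>\<^bsub>N\<^esub> u x)"
      by (rule M.finsum_cong') (use A u F(1)[OF v] F(1)[OF w] in \<open>auto simp: smult_l_distr subset_iff\<close>)
    also have "\<dots> = h v \<oplus>\<^bsub>N\<^esub> h w"
      using A v w by (simp add: h_eq M.finsum_addf closed)
    finally show "h (v \<oplus>\<^bsub>F\<^esub> w) = h v \<oplus>\<^bsub>N\<^esub> h w" .
  next
    fix a v assume a: "a \<in> carrier R" and v: "v \<in> carrier F"
    have av: "a \<odot>\<^bsub>F\<^esub> v \<in> carrier F" using a v by simp
    have "s (a \<odot>\<^bsub>F\<^esub> v) \<subseteq> s v"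
      using a by (auto simp: ops s_def)
    then have "h (a \<odot>\<^bsub>F\<^esub> v) = (\<Oplus>\<^bsub>N\<^esub>x\<in>s v. (a \<otimes>\<^bsub>R\<^esub> v x) \<odot>\<^bsub>N\<^esub> u x)"
      using h_eq[OF av] F[OF v] by (simp add: ops)
    also have "\<dots> = (\<Oplus>\<^bsub>N\<^esub>x\<in>s v. a \<odot>\<^bsub>N\<^esub> (v x \<odot>\<^bsub>N\<^esub> u x))"
      by (rule M.finsum_cong') (use a u F[OF v] in \<open>auto simp: smult_assoc1 subset_iff\<close>)
    also have "\<dots> = a \<odot>\<^bsub>N\<^esub> h v"
      unfolding h_def using finsum_smult_ldistr[OF F(3)[OF v] a closed[OF v F(2)[OF v]]] by simp
    finally show "h (a \<odot>\<^bsub>F\<^esub> v) = a \<odot>\<^bsub>N\<^esub> h v" .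
  qed
  moreover have "h ` carrier F = carrier N"
  proof (intro equalityI subsetI)
    fix y assume y: "y \<in> carrier N"
    define v where "v = (\<lambda>x. if x = code y then \<one>\<^bsub>R\<^esub> else \<zero>\<^bsub>R\<^esub>)"
    have y': "code y \<in> X" "u (code y) = y"
      using y inj by (auto simp: X_def u_def)
    have v: "v \<in> carrier F"
      using y' by (auto simp: F_def free_module_def v_def)
    have "h v = (\<Oplus>\<^bsub>N\<^esub>x\<in>{code y}. v x \<odot>\<^bsub>N\<^esub> u x)"
      by (rule h_eq[OF v]) (use y' in \<open>auto simp: s_def v_def\<close>)
    also have "\<dots> = y"
      using y y' by (simp add: v_def)
    finally show "y \<in> h ` carrier F" using v by blast
  qed (use \<open>h \<in> mod_hom R F N\<close> in \<open>auto simp: mod_hom_def\<close>)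
  ultimately show ?thesis
    by (auto simp: F_def X_def)
qed

lemma submodule_a_kernel:
  assumes "module R M" "module R N" "h \<in> mod_hom R M N"
  shows "submodule (a_kernel M N h) R M"
proof -
  interpret M: module R M by fact
  interpret N: module R N by fact
  have add: "h (x \<oplus>\<^bsub>M\<^esub> y) = h x \<oplus>\<^bsub>N\<^esub> h y" if "x \<in> carrier M" "y \<in> carrier M" for x y
    using assms(3) that by (auto simp: mod_hom_def)
  have sm: "h (a \<odot>\<^bsub>M\<^esub> x) = a \<odot>\<^bsub>N\<^esub> h x" if "a \<in> carrier R" "x \<in> carrier M" for a x
    using assms(3) that by (auto simp: mod_hom_def)
  have cl: "h x \<in> carrier N" if "x \<in> carrier M" for x
    using assms(3) that by (auto simp: mod_hom_def)
  have ker: "a_kernel M N h = {x \<in> carrier M. h x = \<zero>\<^bsub>N\<^esub>}"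
    by (auto simp: a_kernel_def kernel_def)
  have zero: "h \<zero>\<^bsub>M\<^esub> = \<zero>\<^bsub>N\<^esub>"
    using sm[of "\<zero>\<^bsub>R\<^esub>" "\<zero>\<^bsub>M\<^esub>"] cl by simp
  show ?thesis
  proof (rule M.submoduleI)
    fix x assume x: "x \<in> a_kernel M N h"
    have "\<ominus>\<^bsub>M\<^esub> x = (\<ominus>\<^bsub>R\<^esub> \<one>\<^bsub>R\<^esub>) \<odot>\<^bsub>M\<^esub> x"
      using x by (simp add: ker M.smult_l_minus)
    then show "\<ominus>\<^bsub>M\<^esub> x \<in> a_kernel M N h"
      using x sm[of "\<ominus>\<^bsub>R\<^esub> \<one>\<^bsub>R\<^esub>" x] by (simp add: ker)
  qed (auto simp: ker add sm zero)
qed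

lemma free_module_codable:
  "\<exists>code :: (('r, 'm) res_index \<Rightarrow> 'r) \<Rightarrow> ('r, 'm) res_index.
    inj_on code (carrier (free_module R X))"
proof -
  define l where "l v = (SOME xs. set xs = (\<lambda>x. (v x, x)) ` {x. v x \<noteq> \<zero>\<^bsub>R\<^esub>})"
    for v :: "('r, 'm) res_index \<Rightarrow> 'r"
  have l: "set (l v) = (\<lambda>x. (v x, x)) ` {x. v x \<noteq> \<zero>\<^bsub>R\<^esub>}" if "v \<in> carrier (free_module R X)" for v
    unfolding l_def
    by (rule someI_ex, rule finite_list) (use that in \<open>simp add: free_module_def\<close>)
  have "inj_on (\<lambda>v. Comb (l v)) (carrier (free_module R X))"
  proof (rule inj_onI, rule ext)
    fix v w x
    assume v: "v \<in> carrier (free_module R X)" and w: "w \<in> carrier (free_module R X)"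
      and "Comb (l v) = Comb (l w)"
    then have "set (l v) = set (l w)" by simp
    moreover have "(y, x) \<in> set (l v) \<longleftrightarrow> v x \<noteq> \<zero>\<^bsub>R\<^esub> \<and> y = v x" for y
      unfolding l[OF v] by blast
    moreover have "(y, x) \<in> set (l w) \<longleftrightarrow> w x \<noteq> \<zero>\<^bsub>R\<^esub> \<and> y = w x" for y
      unfolding l[OF w] by blast
    ultimately have "v x \<noteq> \<zero>\<^bsub>R\<^esub> \<and> y = v x \<longleftrightarrow> w x \<noteq> \<zero>\<^bsub>R\<^esub> \<and> y = w x" for y
      by simp
    then show "v x = w x" by metis
  qed
  then show ?thesis by blast
qed

lemma free_resolution_exists:
  fixes R :: "('r, 'a) ring_scheme" and M :: "('r, 'm, 'b) module_scheme"
  assumes "module R M"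
  shows "\<exists>(X :: nat \<Rightarrow> ('r, 'm) res_index set) e d. free_resolution R M X e d"
proof -
  interpret M: module R M by fact
  let ?F = "free_module R :: ('r, 'm) res_index set \<Rightarrow> _"
  have F: "module R (?F X)" for X
    by (rule module_free_module) (rule M.R.is_cring)
  obtain e where e: "e \<in> mod_hom R (?F (Elt ` carrier M)) M"
    "e ` carrier (?F (Elt ` carrier M)) = carrier M"
    using free_module_cover[OF assms, of Elt] by (auto simp: inj_on_def)
  have step: "\<exists>Y. \<exists>h\<in>mod_hom R (?F Y) (?F X). h ` carrier (?F Y) = K"
    if K: "submodule K R (?F X)" for X K
  proof -
    obtain code :: "(('r, 'm) res_index \<Rightarrow> 'r) \<Rightarrow> ('r, 'm) res_index"
      where code: "inj_on code (carrier (?F X))"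
      using free_module_codable by blast
    have sub: "K \<subseteq> carrier (?F X)" using module.submoduleE(1)[OF F K] .
    let ?N = "(?F X)\<lparr>carrier := K\<rparr>"
    have "module R ?N"
      by (rule submodule.submodule_is_module[OF K F])
    from free_module_cover[OF this, of code]
    obtain h where "h \<in> mod_hom R (?F (code ` K)) ?N" "h ` carrier (?F (code ` K)) = K"
      using inj_on_subset[OF code sub] by auto
    moreover from this(1) have "h \<in> mod_hom R (?F (code ` K)) (?F X)"
      using sub by (auto simp: mod_hom_def)
    ultimately show ?thesis by blast
  qed
  define P where "P n = (\<lambda>(X, Y, h). h \<in> mod_hom R (?F Y) (?F X) \<and>
    (n = (0::nat) \<longrightarrow> X = Elt ` carrier M \<and> h ` carrier (?F Y) = a_kernel (?F X) M e))" for n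
  define Q where "Q = (\<lambda>n::nat. \<lambda>(X, Y, h) (X', Z, h').
    X' = Y \<and> h' ` carrier (?F Z) = a_kernel (?F Y) (?F X) h)"
  have "\<exists>t. P 0 t"
    using step[OF submodule_a_kernel[OF F assms e(1)]] by (auto simp: P_def)
  moreover have "\<exists>t'. P (Suc n) t' \<and> Q n t t'" if "P n t" for n t
  proof -
    obtain X Y h where t: "t = (X, Y, h)" by (cases t)
    then have "h \<in> mod_hom R (?F Y) (?F X)" using that by (auto simp: P_def)
    from step[OF submodule_a_kernel[OF F F this]]
    show ?thesis by (auto simp: P_def Q_def t)
  qed
  ultimately obtain t where t: "\<And>n. P n (t n)" "\<And>n. Q n (t n) (t (Suc n))"
    using dependent_nat_choice[of P Q] by blast
  define X where "X n = fst (t n)" for n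
  define d where "d n = snd (snd (t n))" for n
  have Y: "fst (snd (t n)) = X (Suc n)" for n
    using t(2)[of n] by (auto simp: Q_def X_def split: prod.splits)
  have t_eq: "t n = (X n, X (Suc n), d n)" for n
    using Y[of n] by (simp add: X_def d_def prod_eq_iff)
  have "free_resolution R M X e d"
    unfolding free_resolution_def Let_def
    using e t(1)[of 0] t(1) t(2) by (auto simp: t_eq P_def Q_def)
  then show ?thesis by blast
qed

end

theory Submission
  imports Defs
begin

text \<open>
  Adjoin to \<open>R\<close> an element \<open>t\<close> with \<open>t\<^sup>2 = k t + h\<close> and let \<open>S\<close> be the subring \<open>R + C t\<close>.
  The duplication is the case \<open>k = 1\<close>, \<open>h = 0\<close>, and the pseudocanonical cover is the case
  \<open>k = 0\<close>; both are treated at once in the locale \<open>quadratic_cover\<close>. In both cases the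
  quadratic equation has a root \<open>r\<^sub>0\<close> in \<open>R\<close> (namely \<open>0\<close>, or a square root of \<open>h\<close>), so
  \<open>t \<mapsto> r\<^sub>0\<close> defines a retraction \<open>g\<close> of the inclusion of \<open>R\<close>. Its kernel consists of the
  elements \<open>c (t - r\<^sub>0)\<close> with \<open>c\<close> in \<open>C\<close>, whence (i).

  For (ii), the functional \<open>a + c t \<mapsto> c\<close> generates \<open>Hom\<^sub>R(S, C)\<close> over \<open>S\<close>. A homomorphism
  on \<open>S = R \<oplus> C\<close> is given by an element of \<open>C\<close> and an endomorphism of \<open>C\<close>, and since \<open>C\<close>
  is semidualizing the latter is multiplication by a unique ring element
  (\<open>homothety_of_iso_endomorphisms\<close>). These two pieces of data are exactly the coordinates
  of an element of \<open>S\<close>, up to a shift by \<open>k\<close>.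

  For (iii), as an \<open>R\<close>-module \<open>S\<close> is \<open>C\<close> plus a free summand of rank one, so
  \<open>Ext\<^sup>i(S, C)\<close> vanishes along with \<open>Ext\<^sup>i(C, C)\<close>. The two modules come with unrelated chosen
  free resolutions, and the passage between them is the comparison of resolutions: maps lift
  to chain maps (\<open>chain_map_lift\<close>), and chain maps over the zero map are null-homotopic
  (\<open>null_homotopy\<close>). Applied to the difference between the identity and the composite
  through the resolution of \<open>C\<close>, corrected in degree zero by the free summand, this turns
  every cocycle of positive degree into a coboundary (\<open>cohomology_vanishing_retract\<close>).
\<close>

section \<open>Module homomorphisms\<close>

lemma mod_hom_closed: "h \<in> mod_hom R M N \<Longrightarrow> x \<in> carrier M \<Longrightarrow> h x \<in> carrier N"
  by (auto simp: mod_hom_def)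

lemma mod_hom_add:
  "h \<in> mod_hom R M N \<Longrightarrow> x \<in> carrier M \<Longrightarrow> y \<in> carrier M \<Longrightarrow> h (x \<oplus>\<^bsub>M\<^esub> y) = h x \<oplus>\<^bsub>N\<^esub> h y"
  by (auto simp: mod_hom_def)

lemma mod_hom_smult:
  "h \<in> mod_hom R M N \<Longrightarrow> a \<in> carrier R \<Longrightarrow> x \<in> carrier M \<Longrightarrow> h (a \<odot>\<^bsub>M\<^esub> x) = a \<odot>\<^bsub>N\<^esub> h x"
  by (auto simp: mod_hom_def)

lemma mod_homI:
  assumes "\<And>x. x \<in> carrier M \<Longrightarrow> h x \<in> carrier N"
    and "\<And>x y. x \<in> carrier M \<Longrightarrow> y \<in> carrier M \<Longrightarrow> h (x \<oplus>\<^bsub>M\<^esub> y) = h x \<oplus>\<^bsub>N\<^esub> h y"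
    and "\<And>a x. a \<in> carrier R \<Longrightarrow> x \<in> carrier M \<Longrightarrow> h (a \<odot>\<^bsub>M\<^esub> x) = a \<odot>\<^bsub>N\<^esub> h x"
  shows "h \<in> mod_hom R M N"
  using assms by (auto simp: mod_hom_def)

lemma mod_hom_zero:
  assumes "module R M" "module R N" "h \<in> mod_hom R M N"
  shows "h \<zero>\<^bsub>M\<^esub> = \<zero>\<^bsub>N\<^esub>"
proof -
  interpret M: module R M by fact
  interpret N: module R N by fact
  show ?thesis
    using mod_hom_smult[OF assms(3), of "\<zero>\<^bsub>R\<^esub>" "\<zero>\<^bsub>M\<^esub>"] mod_hom_closed[OF assms(3), of "\<zero>\<^bsub>M\<^esub>"]
    by simp
qed

lemma mod_hom_uminus:
  assumes "module R M" "module R N" "h \<in> mod_hom R M N" "x \<in> carrier M"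
  shows "h (\<ominus>\<^bsub>M\<^esub> x) = \<ominus>\<^bsub>N\<^esub> h x"
proof -
  interpret M: module R M by fact
  interpret N: module R N by fact
  have "h (\<ominus>\<^bsub>M\<^esub> x) \<oplus>\<^bsub>N\<^esub> h x = \<zero>\<^bsub>N\<^esub>"
    using assms(4) mod_hom_add[OF assms(3), of "\<ominus>\<^bsub>M\<^esub> x" x] mod_hom_zero[OF assms(1-3)]
    by (simp add: M.M.l_neg)
  then show ?thesis
    using assms(4) mod_hom_closed[OF assms(3)] by (metis M.M.a_inv_closed N.M.minus_equality)
qed

lemma mod_hom_diff:
  assumes "module R M" "module R N" "h \<in> mod_hom R M N" "x \<in> carrier M" "y \<in> carrier M"
  shows "h (x \<ominus>\<^bsub>M\<^esub> y) = h x \<ominus>\<^bsub>N\<^esub> h y"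
proof -
  interpret M: module R M by fact
  show ?thesis
    using assms by (simp add: a_minus_def mod_hom_add mod_hom_uminus)
qed

lemma mod_hom_id: "(\<lambda>x. x) \<in> mod_hom R M M"
  by (auto simp: mod_hom_def)

lemma mod_hom_compose:
  assumes "h \<in> mod_hom R L M" "k \<in> mod_hom R M N"
  shows "(\<lambda>x. k (h x)) \<in> mod_hom R L N"
  using assms by (auto simp: mod_hom_def Pi_iff)

lemma mod_hom_add_hom:
  assumes "module R N" "h \<in> mod_hom R M N" "k \<in> mod_hom R M N"
  shows "(\<lambda>x. h x \<oplus>\<^bsub>N\<^esub> k x) \<in> mod_hom R M N"
proof -
  interpret N: module R N by fact
  show ?thesis
    using assms(2,3) by (auto simp: mod_hom_def Pi_iff N.smult_r_distr N.M.a_ac)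
qed

lemma mod_hom_uminus_hom:
  assumes "module R N" "h \<in> mod_hom R M N"
  shows "(\<lambda>x. \<ominus>\<^bsub>N\<^esub> h x) \<in> mod_hom R M N"
proof -
  interpret N: module R N by fact
  show ?thesis
    using assms(2) by (auto simp: mod_hom_def Pi_iff N.smult_r_minus N.M.minus_add)
qed

lemma mod_hom_diff_hom:
  assumes "module R N" "h \<in> mod_hom R M N" "k \<in> mod_hom R M N"
  shows "(\<lambda>x. h x \<ominus>\<^bsub>N\<^esub> k x) \<in> mod_hom R M N"
  unfolding a_minus_def by (intro mod_hom_add_hom mod_hom_uminus_hom assms)

lemma mod_hom_restrict:
  assumes "module R M" "h \<in> mod_hom R M N"
  shows "restrict h (carrier M) \<in> mod_hom R M N"
proof -
  interpret M: module R M by fact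
  show ?thesis using assms(2) by (auto simp: mod_hom_def Pi_iff)
qed

lemma mod_isomorphic_sym:
  assumes "module R M" "mod_isomorphic R M N"
  shows "mod_isomorphic R N M"
proof -
  interpret M: module R M by fact
  obtain h where h: "h \<in> mod_hom R M N" and bij: "bij_betw h (carrier M) (carrier N)"
    using assms(2) by (auto simp: mod_isomorphic_def)
  let ?k = "inv_into (carrier M) h"
  have k: "?k y \<in> carrier M" "h (?k y) = y" if "y \<in> carrier N" for y
    using that bij by (auto simp: bij_betw_def inv_into_into f_inv_into_f)
  have kh: "?k (h x) = x" if "x \<in> carrier M" for x
    using that bij by (simp add: bij_betw_def)
  have "?k \<in> mod_hom R N M"
  proof (rule mod_homI)
    fix x y assume xy: "x \<in> carrier N" "y \<in> carrier N"
    show "?k (x \<oplus>\<^bsub>N\<^esub> y) = ?k x \<oplus>\<^bsub>M\<^esub> ?k y"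
      using kh[of "?k x \<oplus>\<^bsub>M\<^esub> ?k y"] xy k by (simp add: mod_hom_add[OF h])
  next
    fix a x assume ax: "a \<in> carrier R" "x \<in> carrier N"
    show "?k (a \<odot>\<^bsub>N\<^esub> x) = a \<odot>\<^bsub>M\<^esub> ?k x"
      using kh[of "a \<odot>\<^bsub>M\<^esub> ?k x"] ax k by (simp add: mod_hom_smult[OF h])
  qed (rule k)
  then show ?thesis
    using bij_betw_inv_into[OF bij] by (auto simp: mod_isomorphic_def)
qed

lemma module_ring_module:
  assumes "cring R"
  shows "module R (ring_module R)"
proof -
  interpret cring R by fact
  show ?thesis
  proof (intro moduleI abelian_groupI, goal_cases)
    case (7 x)
    then show ?case
      by (intro bexI[of _ "\<ominus>\<^bsub>R\<^esub> x"]) (auto simp: ring_module_def l_neg)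
  qed (auto simp: ring_module_def is_cring a_ac m_assoc l_distr r_distr)
qed

text \<open>
  The isomorphism need not be the homothety map. But the image \<open>u\<close> of \<open>1\<close> generates
  all endomorphisms, in particular the identity: \<open>r u = id\<close> for some \<open>r\<close>. Hence \<open>u\<close> is
  invertible, and expressing \<open>\<phi> \<circ> u\<close> as \<open>s u\<close> gives \<open>\<phi> = s\<close>.
\<close>

lemma homothety_of_iso_endomorphisms:
  assumes "module R M" and iso: "mod_isomorphic R (ring_module R) (Hom_module R M M)"
  shows endomorphism_is_homothety:
      "\<And>\<phi>. \<phi> \<in> mod_hom R M M \<Longrightarrow> \<exists>s\<in>carrier R. \<forall>x\<in>carrier M. \<phi> x = s \<odot>\<^bsub>M\<^esub> x"
    and homothety_faithful:
      "\<And>s s'. s \<in> carrier R \<Longrightarrow> s' \<in> carrier R \<Longrightarrow>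
        (\<And>x. x \<in> carrier M \<Longrightarrow> s \<odot>\<^bsub>M\<^esub> x = s' \<odot>\<^bsub>M\<^esub> x) \<Longrightarrow> s = s'"
proof -
  interpret M: module R M by fact
  obtain \<beta> where \<beta>: "\<beta> \<in> mod_hom R (ring_module R) (Hom_module R M M)"
    and bij: "bij_betw \<beta> (carrier R) (carrier (Hom_module R M M))"
    using iso by (auto simp: mod_isomorphic_def ring_module_def)
  define u where "u = \<beta> \<one>\<^bsub>R\<^esub>"
  have u: "u \<in> mod_hom R M M"
    using mod_hom_closed[OF \<beta>, of "\<one>\<^bsub>R\<^esub>"] by (simp add: u_def ring_module_def Hom_module_def)
  have \<beta>_eq: "\<beta> s = (\<lambda>x\<in>carrier M. s \<odot>\<^bsub>M\<^esub> u x)" if "s \<in> carrier R" for s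
    using mod_hom_smult[OF \<beta> that, of "\<one>\<^bsub>R\<^esub>"] that
    by (simp add: ring_module_def Hom_module_def u_def)
  have ex: "\<exists>s\<in>carrier R. \<forall>x\<in>carrier M. \<phi> x = s \<odot>\<^bsub>M\<^esub> u x" if "\<phi> \<in> mod_hom R M M" for \<phi>
  proof -
    have "restrict \<phi> (carrier M) \<in> carrier (Hom_module R M M)"
      using mod_hom_restrict[OF assms(1) that] by (simp add: Hom_module_def)
    then obtain s where s: "s \<in> carrier R" "restrict \<phi> (carrier M) = \<beta> s"
      using bij by (auto simp: bij_betw_def)
    have "\<phi> x = s \<odot>\<^bsub>M\<^esub> u x" if "x \<in> carrier M" for x
      using fun_cong[OF s(2), of x] that by (simp add: \<beta>_eq[OF s(1)])
    with s(1) show ?thesis by blast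
  qed
  have ucl: "u x \<in> carrier M" if "x \<in> carrier M" for x
    using u that by (rule mod_hom_closed)
  obtain r where r: "r \<in> carrier R" "\<And>x. x \<in> carrier M \<Longrightarrow> x = r \<odot>\<^bsub>M\<^esub> u x"
    using ex[OF mod_hom_id] by blast
  show "\<exists>s\<in>carrier R. \<forall>x\<in>carrier M. \<phi> x = s \<odot>\<^bsub>M\<^esub> x" if \<phi>: "\<phi> \<in> mod_hom R M M" for \<phi>
  proof -
    obtain s where s: "s \<in> carrier R" "\<And>x. x \<in> carrier M \<Longrightarrow> \<phi> (u x) = s \<odot>\<^bsub>M\<^esub> u x"
      using ex[OF mod_hom_compose[OF u \<phi>]] by blast
    have "\<phi> x = s \<odot>\<^bsub>M\<^esub> x" if x: "x \<in> carrier M" for x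
    proof -
      have "\<phi> x = \<phi> (r \<odot>\<^bsub>M\<^esub> u x)"
        using r(2)[OF x] by simp
      also have "\<dots> = r \<odot>\<^bsub>M\<^esub> (s \<odot>\<^bsub>M\<^esub> u x)"
        using mod_hom_smult[OF \<phi> r(1) ucl[OF x]] s(2)[OF x] by simp
      also have "\<dots> = s \<odot>\<^bsub>M\<^esub> (r \<odot>\<^bsub>M\<^esub> u x)"
        using r(1) s(1) ucl[OF x] by (metis M.R.m_comm M.smult_assoc1)
      finally show ?thesis
        using r(2)[OF x] by simp
    qed
    with s(1) show ?thesis by blast
  qed
  show "s = s'" if s: "s \<in> carrier R" "s' \<in> carrier R"
    and eq: "\<And>x. x \<in> carrier M \<Longrightarrow> s \<odot>\<^bsub>M\<^esub> x = s' \<odot>\<^bsub>M\<^esub> x" for s s'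
  proof -
    have "\<beta> s = \<beta> s'"
      using s eq ucl by (simp add: \<beta>_eq cong: restrict_cong)
    with s bij show ?thesis by (auto simp: bij_betw_def inj_on_def)
  qed
qed

section \<open>Free modules are projective\<close>

definition basis_vector :: "('r, 'a) ring_scheme \<Rightarrow> 'x \<Rightarrow> 'x \<Rightarrow> 'r"
  where "basis_vector R x = (\<lambda>y. if y = x then \<one>\<^bsub>R\<^esub> else \<zero>\<^bsub>R\<^esub>)"

lemma basis_vector_closed:
  assumes "cring R" "x \<in> X"
  shows "basis_vector R x \<in> carrier (free_module R X)"
proof -
  interpret cring R by fact
  have "{y. basis_vector R x y \<noteq> \<zero>\<^bsub>R\<^esub>} \<subseteq> {x}" by (auto simp: basis_vector_def)
  then have "finite {y. basis_vector R x y \<noteq> \<zero>\<^bsub>R\<^esub>}" by (rule finite_subset) simp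
  then show ?thesis using assms(2) by (auto simp: free_module_def basis_vector_def)
qed

text \<open>Existence in the universal property of the free module; uniqueness is
  \<open>free_module_hom_eqI\<close>.\<close>

lemma free_module_extend:
  fixes u :: "'x \<Rightarrow> 'm"
  assumes "module R M" and u: "\<And>x. x \<in> X \<Longrightarrow> u x \<in> carrier M"
  shows "\<exists>h\<in>mod_hom R (free_module R X) M. \<forall>x\<in>X. h (basis_vector R x) = u x"
proof -
  interpret module R M by fact
  define s where "s v = {x. v x \<noteq> \<zero>\<^bsub>R\<^esub>}" for v :: "'x \<Rightarrow> 'a"
  define h where "h v = (\<Oplus>\<^bsub>M\<^esub>x\<in>s v. v x \<odot>\<^bsub>M\<^esub> u x)" for v
  let ?F = "free_module R X"
  have F: "v x \<in> carrier R" "s v \<subseteq> X" "finite (s v)" if "v \<in> carrier ?F" for v x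
    using that by (cases "x \<in> X"; auto simp: free_module_def s_def)+
  interpret F: module R ?F
    by (rule module_free_module) (rule R.is_cring)
  have closed: "(\<lambda>x. v x \<odot>\<^bsub>M\<^esub> u x) \<in> A \<rightarrow> carrier M" if "v \<in> carrier ?F" "A \<subseteq> X" for v A
    using that u F(1) by auto
  \<comment> \<open>The sum may be taken over any larger finite set, so that two vectors can be added.\<close>
  have h_eq: "h v = (\<Oplus>\<^bsub>M\<^esub>x\<in>A. v x \<odot>\<^bsub>M\<^esub> u x)"
    if "v \<in> carrier ?F" "finite A" "s v \<subseteq> A" "A \<subseteq> X" for v A
    unfolding h_def
  proof (rule M.add.finprod_mono_neutral_cong_left)
    show "\<And>i. i \<in> A - s v \<Longrightarrow> v i \<odot>\<^bsub>M\<^esub> u i = \<zero>\<^bsub>M\<^esub>"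
      using that u by (auto simp: s_def)
    show "(\<lambda>x. v x \<odot>\<^bsub>M\<^esub> u x) \<in> A \<rightarrow> carrier M"
      using closed that by blast
  qed (use that in auto)
  have ops: "v \<oplus>\<^bsub>?F\<^esub> w = (\<lambda>x. v x \<oplus>\<^bsub>R\<^esub> w x)" "a \<odot>\<^bsub>?F\<^esub> v = (\<lambda>x. a \<otimes>\<^bsub>R\<^esub> v x)" for a v w
    by (auto simp: free_module_def)
  have "h \<in> mod_hom R ?F M"
  proof (rule mod_homI)
    fix v assume v: "v \<in> carrier ?F"
    show "h v \<in> carrier M"
      unfolding h_def by (rule M.finsum_closed) (rule closed[OF v F(2)[OF v]])
    fix w assume w: "w \<in> carrier ?F"
    define A where "A = s v \<union> s w"
    have A: "finite A" "A \<subseteq> X" "s v \<subseteq> A" "s w \<subseteq> A"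
      using F(2,3)[OF v] F(2,3)[OF w] by (auto simp: A_def)
    have vw: "v \<oplus>\<^bsub>?F\<^esub> w \<in> carrier ?F" using v w by simp
    have "s (v \<oplus>\<^bsub>?F\<^esub> w) \<subseteq> A"
      by (auto simp: ops s_def A_def)
    then have "h (v \<oplus>\<^bsub>?F\<^esub> w) = (\<Oplus>\<^bsub>M\<^esub>x\<in>A. (v x \<oplus>\<^bsub>R\<^esub> w x) \<odot>\<^bsub>M\<^esub> u x)"
      using h_eq[OF vw] A by (simp add: ops)
    also have "\<dots> = (\<Oplus>\<^bsub>M\<^esub>x\<in>A. v x \<odot>\<^bsub>M\<^esub> u x \<oplus>\<^bsub>M\<^esub> w x \<odot>\<^bsub>M\<^esub> u x)"
      by (rule M.finsum_cong') (use A u F(1)[OF v] F(1)[OF w] in \<open>auto simp: smult_l_distr subset_iff\<close>)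
    also have "\<dots> = h v \<oplus>\<^bsub>M\<^esub> h w"
      using A v w by (simp add: h_eq M.finsum_addf closed)
    finally show "h (v \<oplus>\<^bsub>?F\<^esub> w) = h v \<oplus>\<^bsub>M\<^esub> h w" .
  next
    fix a v assume a: "a \<in> carrier R" and v: "v \<in> carrier ?F"
    have av: "a \<odot>\<^bsub>?F\<^esub> v \<in> carrier ?F" using a v by simp
    have "s (a \<odot>\<^bsub>?F\<^esub> v) \<subseteq> s v"
      using a by (auto simp: ops s_def)
    then have "h (a \<odot>\<^bsub>?F\<^esub> v) = (\<Oplus>\<^bsub>M\<^esub>x\<in>s v. (a \<otimes>\<^bsub>R\<^esub> v x) \<odot>\<^bsub>M\<^esub> u x)"
      using h_eq[OF av] F[OF v] by (simp add: ops)
    also have "\<dots> = (\<Oplus>\<^bsub>M\<^esub>x\<in>s v. a \<odot>\<^bsub>M\<^esub> (v x \<odot>\<^bsub>M\<^esub> u x))"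
      by (rule M.finsum_cong') (use a u F[OF v] in \<open>auto simp: smult_assoc1 subset_iff\<close>)
    also have "\<dots> = a \<odot>\<^bsub>M\<^esub> h v"
      unfolding h_def using finsum_smult_ldistr[OF F(3)[OF v] a closed[OF v F(2)[OF v]]] by simp
    finally show "h (a \<odot>\<^bsub>?F\<^esub> v) = a \<odot>\<^bsub>M\<^esub> h v" .
  qed
  moreover have "h (basis_vector R x) = u x" if x: "x \<in> X" for x
  proof -
    have "h (basis_vector R x) = (\<Oplus>\<^bsub>M\<^esub>y\<in>{x}. basis_vector R x y \<odot>\<^bsub>M\<^esub> u y)"
      by (rule h_eq) (use x basis_vector_closed[OF R.is_cring x] in \<open>auto simp: s_def basis_vector_def\<close>)
    also have "\<dots> = u x"
      using x u by (simp add: basis_vector_def)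
    finally show ?thesis .
  qed
  ultimately show ?thesis by blast
qed

lemma free_module_hom_eqI:
  fixes N :: "('r, 'n, 'c) module_scheme"
  assumes "cring R" "module R N"
    and \<phi>: "\<phi> \<in> mod_hom R (free_module R X) N" and \<psi>: "\<psi> \<in> mod_hom R (free_module R X) N"
    and eq: "\<And>x. x \<in> X \<Longrightarrow> \<phi> (basis_vector R x) = \<psi> (basis_vector R x)"
    and v: "v \<in> carrier (free_module R X)"
  shows "\<phi> v = \<psi> v"
proof -
  interpret cring R by fact
  let ?F = "free_module R X"
  have F: "module R ?F" by (rule module_free_module) fact
  interpret F: module R ?F by fact
  have "\<phi> v = \<psi> v" if "finite A" "v \<in> carrier ?F" "{x. v x \<noteq> \<zero>\<^bsub>R\<^esub>} \<subseteq> A" for v A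
    using that
  proof (induction A arbitrary: v rule: finite_induct)
    case empty
    then have "v = \<zero>\<^bsub>?F\<^esub>" by (auto simp: free_module_def)
    then show ?case
      using mod_hom_zero[OF F assms(2) \<phi>] mod_hom_zero[OF F assms(2) \<psi>] by simp
  next
    case (insert a A)
    show ?case
    proof (cases "a \<in> X")
      case False
      then have "v a = \<zero>\<^bsub>R\<^esub>" using insert.prems by (auto simp: free_module_def)
      then show ?thesis using insert by (intro insert.IH) auto
    next
      case True
      define w where "w = v(a := \<zero>\<^bsub>R\<^esub>)"
      have va: "v a \<in> carrier R" and vc: "v x \<in> carrier R" for x
        using insert.prems(1) by (cases "x \<in> X"; auto simp: free_module_def True)+
      have "{x. w x \<noteq> \<zero>\<^bsub>R\<^esub>} \<subseteq> {x. v x \<noteq> \<zero>\<^bsub>R\<^esub>}"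
        by (auto simp: w_def)
      then have "finite {x. w x \<noteq> \<zero>\<^bsub>R\<^esub>}"
        by (rule finite_subset) (use insert.prems(1) in \<open>simp add: free_module_def\<close>)
      then have w: "w \<in> carrier ?F"
        using insert.prems(1) by (auto simp: free_module_def w_def)
      moreover have "\<phi> w = \<psi> w"
        by (rule insert.IH[OF w]) (use insert.prems(2) in \<open>auto simp: w_def\<close>)
      moreover have "v = w \<oplus>\<^bsub>?F\<^esub> v a \<odot>\<^bsub>?F\<^esub> basis_vector R a"
        using vc by (auto simp: free_module_def w_def basis_vector_def fun_eq_iff)
      moreover note b = basis_vector_closed[OF assms(1) True]
      ultimately show ?thesis
        using va eq[OF True] b
        by (metis F.smult_closed mod_hom_add[OF \<phi>] mod_hom_add[OF \<psi>] mod_hom_smult[OF \<phi>]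
            mod_hom_smult[OF \<psi>])
    qed
  qed
  moreover have "finite {x. v x \<noteq> \<zero>\<^bsub>R\<^esub>}" using v by (auto simp: free_module_def)
  ultimately show ?thesis using v by blast
qed

lemma free_module_lift:
  assumes "module R M" "module R N" and e: "e \<in> mod_hom R M N"
    and \<phi>: "\<phi> \<in> mod_hom R (free_module R X) N"
    and range: "\<And>v. v \<in> carrier (free_module R X) \<Longrightarrow> \<phi> v \<in> e ` carrier M"
  shows "\<exists>\<psi>\<in>mod_hom R (free_module R X) M. \<forall>v\<in>carrier (free_module R X). e (\<psi> v) = \<phi> v"
proof -
  interpret M: module R M by fact
  have "\<exists>y\<in>carrier M. e y = \<phi> (basis_vector R x)" if "x \<in> X" for x
    using range[OF basis_vector_closed[OF M.R.is_cring that]] by force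
  then obtain u where u: "\<And>x. x \<in> X \<Longrightarrow> u x \<in> carrier M"
    "\<And>x. x \<in> X \<Longrightarrow> e (u x) = \<phi> (basis_vector R x)"
    by metis
  obtain \<psi> where \<psi>: "\<psi> \<in> mod_hom R (free_module R X) M" "\<And>x. x \<in> X \<Longrightarrow> \<psi> (basis_vector R x) = u x"
    using free_module_extend[OF assms(1), of X u] u(1) by blast
  have "e (\<psi> v) = \<phi> v" if "v \<in> carrier (free_module R X)" for v
    by (rule free_module_hom_eqI[OF M.R.is_cring assms(2) mod_hom_compose[OF \<psi>(1) e] \<phi> _ that])
      (simp add: \<psi> u)
  with \<psi>(1) show ?thesis by blast
qed

section \<open>Free resolutions: chain maps and homotopies\<close>

text \<open>Exactness in elementwise form, which is how lifts use it.\<close>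

lemma free_resolutionD:
  assumes "free_resolution R M X e d"
  shows "e \<in> mod_hom R (free_module R (X 0)) M"
    and "\<And>n. d n \<in> mod_hom R (free_module R (X (Suc n))) (free_module R (X n))"
    and "e ` carrier (free_module R (X 0)) = carrier M"
    and "\<And>v. v \<in> carrier (free_module R (X 0)) \<Longrightarrow> e v = \<zero>\<^bsub>M\<^esub> \<Longrightarrow>
      v \<in> d 0 ` carrier (free_module R (X (Suc 0)))"
    and "\<And>v. v \<in> carrier (free_module R (X (Suc 0))) \<Longrightarrow> e (d 0 v) = \<zero>\<^bsub>M\<^esub>"
    and "\<And>n v. v \<in> carrier (free_module R (X (Suc n))) \<Longrightarrow> d n v = \<zero>\<^bsub>free_module R (X n)\<^esub> \<Longrightarrow>
      v \<in> d (Suc n) ` carrier (free_module R (X (Suc (Suc n))))"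
    and "\<And>n v. v \<in> carrier (free_module R (X (Suc (Suc n)))) \<Longrightarrow>
      d n (d (Suc n) v) = \<zero>\<^bsub>free_module R (X n)\<^esub>"
proof -
  note D = assms[unfolded free_resolution_def Let_def a_kernel_def kernel_def, simplified]
  show "e \<in> mod_hom R (free_module R (X 0)) M"
    "\<And>n. d n \<in> mod_hom R (free_module R (X (Suc n))) (free_module R (X n))"
    "e ` carrier (free_module R (X 0)) = carrier M"
    using D by blast+
  show "\<And>v. v \<in> carrier (free_module R (X 0)) \<Longrightarrow> e v = \<zero>\<^bsub>M\<^esub> \<Longrightarrow>
      v \<in> d 0 ` carrier (free_module R (X (Suc 0)))"
    "\<And>v. v \<in> carrier (free_module R (X (Suc 0))) \<Longrightarrow> e (d 0 v) = \<zero>\<^bsub>M\<^esub>"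
    "\<And>n v. v \<in> carrier (free_module R (X (Suc n))) \<Longrightarrow> d n v = \<zero>\<^bsub>free_module R (X n)\<^esub> \<Longrightarrow>
      v \<in> d (Suc n) ` carrier (free_module R (X (Suc (Suc n))))"
    "\<And>n v. v \<in> carrier (free_module R (X (Suc (Suc n)))) \<Longrightarrow>
      d n (d (Suc n) v) = \<zero>\<^bsub>free_module R (X n)\<^esub>"
    using D by blast+
qed

lemma chain_map_lift:
  fixes X :: "nat \<Rightarrow> 'x set" and Y :: "nat \<Rightarrow> 'y set"
  assumes "module R M" "module R N"
    and resX: "free_resolution R M X e d" and resY: "free_resolution R N Y e' d'"
    and a: "a \<in> mod_hom R M N"
  shows "\<exists>P. (\<forall>n. P n \<in> mod_hom R (free_module R (X n)) (free_module R (Y n))) \<and>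
    (\<forall>v\<in>carrier (free_module R (X 0)). e' (P 0 v) = a (e v)) \<and>
    (\<forall>n. \<forall>v\<in>carrier (free_module R (X (Suc n))). d' n (P (Suc n) v) = P n (d n v))"
proof -
  interpret M: module R M by fact
  let ?F = "\<lambda>n. free_module R (X n)" and ?G = "\<lambda>n. free_module R (Y n)"
  have F: "module R (?F n)" and G: "module R (?G n)" for n
    by (rule module_free_module, rule M.R.is_cring)+
  note X = free_resolutionD[OF resX] and Y = free_resolutionD[OF resY]
  \<comment> \<open>A partial lift sends boundaries to cycles, so exactness of the target gives the next lift.\<close>
  define Inv where "Inv n p \<longleftrightarrow> p \<in> mod_hom R (?F n) (?G n) \<and>
    (case n of 0 \<Rightarrow> \<forall>v\<in>carrier (?F 0). e' (p v) = a (e v)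
     | Suc m \<Rightarrow> \<forall>v\<in>carrier (?F (Suc n)). d' m (p (d n v)) = \<zero>\<^bsub>?G m\<^esub>)" for n p
  define Step where
    "Step n p q \<longleftrightarrow> (\<forall>v\<in>carrier (?F (Suc n)). d' n (q v) = p (d n v))" for n and p q :: "('x \<Rightarrow> 'a) \<Rightarrow> 'y \<Rightarrow> 'a"
  have "\<exists>p. Inv 0 p"
    using free_module_lift[OF G assms(2) Y(1) mod_hom_compose[OF X(1) a]]
      mod_hom_closed[OF X(1)] mod_hom_closed[OF a] Y(3)
    by (auto simp: Inv_def)
  moreover have "\<exists>q. Inv (Suc n) q \<and> Step n p q" if p: "Inv n p" for n p
  proof -
    have ph: "p \<in> mod_hom R (?F n) (?G n)" using p by (simp add: Inv_def)
    have "p (d n v) \<in> d' n ` carrier (?G (Suc n))" if v: "v \<in> carrier (?F (Suc n))" for v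
    proof (cases n)
      case 0
      have "e' (p (d 0 v)) = a \<zero>\<^bsub>M\<^esub>"
        using p v X(5) mod_hom_closed[OF X(2)] by (auto simp: Inv_def 0)
      then show ?thesis
        using v mod_hom_zero[OF assms(1,2) a] Y(4) mod_hom_closed[OF X(2)] mod_hom_closed[OF ph]
        by (simp add: 0)
    next
      case (Suc m)
      have "d' m (p (d n v)) = \<zero>\<^bsub>?G m\<^esub>"
        using p v by (auto simp: Inv_def Suc)
      then show ?thesis
        using v Y(6) mod_hom_closed[OF X(2)] mod_hom_closed[OF ph] by (simp add: Suc)
    qed
    then obtain q where q: "q \<in> mod_hom R (?F (Suc n)) (?G (Suc n))"
      "\<And>v. v \<in> carrier (?F (Suc n)) \<Longrightarrow> d' n (q v) = p (d n v)"
      using free_module_lift[OF G G Y(2) mod_hom_compose[OF X(2) ph]] by blast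
    have "d' n (q (d (Suc n) v)) = \<zero>\<^bsub>?G n\<^esub>" if "v \<in> carrier (?F (Suc (Suc n)))" for v
      using q(2) mod_hom_closed[OF X(2)] that X(7)[OF that] mod_hom_zero[OF F G ph] by simp
    with q show ?thesis by (auto simp: Inv_def Step_def)
  qed
  ultimately obtain P where P: "\<And>n. Inv n (P n)" "\<And>n. Step n (P n) (P (Suc n))"
    using dependent_nat_choice[of Inv Step] by blast
  show ?thesis
  proof (intro exI[of _ P] conjI allI ballI)
    show "P n \<in> mod_hom R (?F n) (?G n)" for n using P(1)[of n] by (simp add: Inv_def)
    show "e' (P 0 v) = a (e v)" if "v \<in> carrier (?F 0)" for v
      using P(1)[of 0] that by (simp add: Inv_def)
    show "d' n (P (Suc n) v) = P n (d n v)" if "v \<in> carrier (?F (Suc n))" for n v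
      using P(2)[of n] that by (simp add: Step_def)
  qed
qed

text \<open>
  A chain map covering the zero map is homotopic to zero. The homotopy identity is recorded
  only in positive degrees, where cohomology is to vanish.
\<close>

lemma null_homotopy:
  fixes X :: "nat \<Rightarrow> 'x set" and Y :: "nat \<Rightarrow> 'y set"
  assumes "module R N"
    and resX: "free_resolution R M X e d" and resY: "free_resolution R N Y e' d'"
    and T: "\<And>n. T n \<in> mod_hom R (free_module R (X n)) (free_module R (Y n))"
    and T0: "\<And>v. v \<in> carrier (free_module R (X 0)) \<Longrightarrow> e' (T 0 v) = \<zero>\<^bsub>N\<^esub>"
    and dT: "\<And>n v. v \<in> carrier (free_module R (X (Suc n))) \<Longrightarrow> d' n (T (Suc n) v) = T n (d n v)"
  shows "\<exists>s. (\<forall>n. s n \<in> mod_hom R (free_module R (X n)) (free_module R (Y (Suc n)))) \<and>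
    (\<forall>n. \<forall>v\<in>carrier (free_module R (X (Suc n))).
      T (Suc n) v = d' (Suc n) (s (Suc n) v) \<oplus>\<^bsub>free_module R (Y (Suc n))\<^esub> s n (d n v))"
proof -
  interpret N: module R N by fact
  let ?F = "\<lambda>n. free_module R (X n)" and ?G = "\<lambda>n. free_module R (Y n)"
  have F: "module R (?F n)" and G: "module R (?G n)" for n
    by (rule module_free_module, rule N.R.is_cring)+
  note X = free_resolutionD[OF resX] and Y = free_resolutionD[OF resY]
  note dX = X(2)
  \<comment> \<open>The invariant makes the error \<open>T (Suc n) - s n \<circ> d n\<close> a cycle, hence a boundary.\<close>
  define Inv where "Inv n s \<longleftrightarrow> s \<in> mod_hom R (?F n) (?G (Suc n)) \<and>
    (\<forall>v\<in>carrier (?F (Suc n)). d' n (s (d n v)) = T n (d n v))" for n s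
  define Step where "Step n s t \<longleftrightarrow> (\<forall>v\<in>carrier (?F (Suc n)).
    T (Suc n) v = d' (Suc n) (t v) \<oplus>\<^bsub>?G (Suc n)\<^esub> s (d n v))"
    for n and s t :: "('x \<Rightarrow> 'a) \<Rightarrow> 'y \<Rightarrow> 'a"
  have "T 0 v \<in> d' 0 ` carrier (?G (Suc 0))" if "v \<in> carrier (?F 0)" for v
    using Y(4) T0 mod_hom_closed[OF T] that by blast
  then obtain s0 where "s0 \<in> mod_hom R (?F 0) (?G (Suc 0))"
    "\<And>v. v \<in> carrier (?F 0) \<Longrightarrow> d' 0 (s0 v) = T 0 v"
    using free_module_lift[OF G[of "Suc 0"] G[of 0] Y(2)[of 0] T[of 0]] by blast
  then have "\<exists>s. Inv 0 s"
    using mod_hom_closed[OF dX] by (intro exI[of _ s0]) (simp add: Inv_def)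
  moreover have "\<exists>t. Inv (Suc n) t \<and> Step n s t" if s: "Inv n s" for n s
  proof -
    interpret G: module R "?G (Suc n)" by (rule G)
    interpret Gn: module R "?G n" by (rule G)
    have sh: "s \<in> mod_hom R (?F n) (?G (Suc n))" using s by (simp add: Inv_def)
    define E where "E v = T (Suc n) v \<ominus>\<^bsub>?G (Suc n)\<^esub> s (d n v)" for v
    have E: "E \<in> mod_hom R (?F (Suc n)) (?G (Suc n))"
      unfolding E_def by (intro mod_hom_diff_hom G T mod_hom_compose[OF dX sh])
    have cl: "T (Suc n) v \<in> carrier (?G (Suc n))" "s (d n v) \<in> carrier (?G (Suc n))"
      "d n v \<in> carrier (?F n)" "T n (d n v) \<in> carrier (?G n)"
      if "v \<in> carrier (?F (Suc n))" for v
      using that mod_hom_closed[OF T] mod_hom_closed[OF sh] mod_hom_closed[OF dX] by auto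
    have "E v \<in> d' (Suc n) ` carrier (?G (Suc (Suc n)))" if v: "v \<in> carrier (?F (Suc n))" for v
    proof (rule Y(6))
      show "E v \<in> carrier (?G (Suc n))" using mod_hom_closed[OF E v] .
      have "d' n (E v) = T n (d n v) \<ominus>\<^bsub>?G n\<^esub> T n (d n v)"
        unfolding E_def using mod_hom_diff[OF G G Y(2) cl(1,2)[OF v]] dT[OF v] s v
        by (simp add: Inv_def)
      then show "d' n (E v) = \<zero>\<^bsub>?G n\<^esub>"
        using cl[OF v] by (simp add: Gn.M.r_neg a_minus_def)
    qed
    then obtain t where t: "t \<in> mod_hom R (?F (Suc n)) (?G (Suc (Suc n)))"
      "\<And>v. v \<in> carrier (?F (Suc n)) \<Longrightarrow> d' (Suc n) (t v) = E v"
      using free_module_lift[OF G G Y(2) E] by blast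
    have st: "Step n s t"
      unfolding Step_def using t(2) cl by (auto simp: E_def a_minus_def G.M.a_assoc G.M.l_neg)
    have "d' (Suc n) (t (d (Suc n) v)) = T (Suc n) (d (Suc n) v)"
      if v: "v \<in> carrier (?F (Suc (Suc n)))" for v
    proof -
      have dv: "d (Suc n) v \<in> carrier (?F (Suc n))"
        using mod_hom_closed[OF dX v] .
      have "E (d (Suc n) v) = T (Suc n) (d (Suc n) v)"
        unfolding E_def X(7)[OF v] mod_hom_zero[OF F G sh]
        using cl(1)[OF dv] by (simp add: a_minus_def)
      then show ?thesis
        using t(2)[OF dv] by simp
    qed
    with t st show ?thesis by (auto simp: Inv_def)
  qed
  ultimately obtain s where s: "\<And>n. Inv n (s n)" "\<And>n. Step n (s n) (s (Suc n))"
    using dependent_nat_choice[of Inv Step] by blast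
  then show ?thesis
    by (auto simp: Inv_def Step_def intro!: exI[of _ s])
qed

section \<open>Cohomology of Hom complexes\<close>

lemma module_Hom_module:
  assumes "module R M" "module R N"
  shows "module R (Hom_module R M N)"
proof -
  interpret M: module R M by fact
  interpret N: module R N by fact
  have ops: "carrier (Hom_module R M N) = mod_hom R M N \<inter> extensional (carrier M)"
    "\<phi> \<oplus>\<^bsub>Hom_module R M N\<^esub> \<psi> = (\<lambda>x\<in>carrier M. \<phi> x \<oplus>\<^bsub>N\<^esub> \<psi> x)"
    "a \<odot>\<^bsub>Hom_module R M N\<^esub> \<phi> = (\<lambda>x\<in>carrier M. a \<odot>\<^bsub>N\<^esub> \<phi> x)"
    "\<zero>\<^bsub>Hom_module R M N\<^esub> = (\<lambda>x\<in>carrier M. \<zero>\<^bsub>N\<^esub>)" for \<phi> \<psi> a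
    by (simp_all add: Hom_module_def)
  note cl = mod_hom_closed[of _ R M N]
  have smult: "(\<lambda>x. a \<odot>\<^bsub>N\<^esub> \<phi> x) \<in> mod_hom R M N" if "a \<in> carrier R" "\<phi> \<in> mod_hom R M N" for a \<phi>
    using that
    by (auto simp: mod_hom_def Pi_iff N.smult_r_distr M.R.m_comm simp flip: N.smult_assoc1)
  have zero: "(\<lambda>x. \<zero>\<^bsub>N\<^esub>) \<in> mod_hom R M N"
    by (auto simp: mod_hom_def)
  note hom = mod_hom_restrict[OF assms(1)] mod_hom_add_hom[OF assms(2)]
  show ?thesis
  proof (intro moduleI abelian_groupI, goal_cases)
    case (7 \<phi>)
    then have "restrict (\<lambda>x. \<ominus>\<^bsub>N\<^esub> \<phi> x) (carrier M) \<in> carrier (Hom_module R M N)"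
      by (simp add: ops hom mod_hom_uminus_hom[OF assms(2)])
    moreover have "restrict (\<lambda>x. \<ominus>\<^bsub>N\<^esub> \<phi> x) (carrier M) \<oplus>\<^bsub>Hom_module R M N\<^esub> \<phi> = \<zero>\<^bsub>Hom_module R M N\<^esub>"
      using 7 by (auto simp: ops fun_eq_iff cl N.M.l_neg)
    ultimately show ?case by blast
  qed (simp_all add: ops extensional_def hom smult zero M.R.is_cring fun_eq_iff cl
      N.M.a_ac N.smult_l_distr N.smult_r_distr N.smult_assoc1)
qed

lemma precompose_mod_hom:
  assumes "module R L" and k: "k \<in> mod_hom R L M"
  shows "(\<lambda>\<phi>. compose (carrier L) \<phi> k) \<in> mod_hom R (Hom_module R M N) (Hom_module R L N)"
proof (rule mod_homI)
  fix \<phi> assume "\<phi> \<in> carrier (Hom_module R M N)"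
  then have "(\<lambda>x. \<phi> (k x)) \<in> mod_hom R L N"
    using mod_hom_compose[OF k, of \<phi> N] by (simp add: Hom_module_def)
  then show "compose (carrier L) \<phi> k \<in> carrier (Hom_module R L N)"
    using mod_hom_restrict[OF assms(1)] by (simp add: Hom_module_def compose_def)
qed (auto simp: Hom_module_def compose_def mod_hom_closed[OF k] fun_eq_iff)

text \<open>Through \<open>precompose_mod_hom\<close> this shows that coboundaries form a subgroup, so that the
  quotient of cocycles by coboundaries behaves as a group of cosets.\<close>

lemma additive_subgroup_mod_hom_image:
  assumes "module R M" "module R N" and h: "h \<in> mod_hom R M N"
  shows "additive_subgroup (h ` carrier M) N"
proof -
  interpret M: module R M by fact
  interpret N: module R N by fact
  show ?thesis
  proof (rule additive_subgroupI, rule N.M.add.subgroupI)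
    show "h ` carrier M \<subseteq> carrier N" using mod_hom_closed[OF h] by auto
    show "h ` carrier M \<noteq> {}" by auto
    fix y assume "y \<in> h ` carrier M"
    then obtain x where x: "x \<in> carrier M" "y = h x" by auto
    show "\<ominus>\<^bsub>N\<^esub> y \<in> h ` carrier M"
      unfolding x(2)
      by (rule image_eqI[of _ _ "\<ominus>\<^bsub>M\<^esub> x"]) (simp_all add: mod_hom_uminus[OF assms] x)
    fix y' assume "y' \<in> h ` carrier M"
    then obtain x' where x': "x' \<in> carrier M" "y' = h x'" by auto
    show "y \<oplus>\<^bsub>N\<^esub> y' \<in> h ` carrier M"
      unfolding x(2) x'(2)
      by (rule image_eqI[of _ _ "x \<oplus>\<^bsub>M\<^esub> x'"]) (simp_all add: mod_hom_add[OF h] x x')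
  qed
qed

lemma zero_quotient_module_iff:
  assumes "abelian_group H" "additive_subgroup K H" "Z \<subseteq> carrier H" "Z \<noteq> {}"
  shows "zero_module (quotient_module (H\<lparr>carrier := Z\<rparr>) K) \<longleftrightarrow> Z \<subseteq> K"
proof -
  interpret abelian_group H by fact
  have coset: "K +>\<^bsub>H\<lparr>carrier := Z\<rparr>\<^esub> x = K +>\<^bsub>H\<^esub> x" for x
    by (simp add: a_r_coset_def')
  have "a_rcosets\<^bsub>H\<lparr>carrier := Z\<rparr>\<^esub> K = (\<lambda>x. K +>\<^bsub>H\<^esub> x) ` Z"
    unfolding A_RCOSETS_def' coset by auto
  then have "zero_module (quotient_module (H\<lparr>carrier := Z\<rparr>) K) \<longleftrightarrow> (\<lambda>x. K +>\<^bsub>H\<^esub> x) ` Z = {K}"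
    by (simp add: zero_module_def quotient_module_def)
  also have "\<dots> \<longleftrightarrow> (\<forall>x\<in>Z. K +>\<^bsub>H\<^esub> x = K)"
    using assms(4) by auto
  also have "\<dots> \<longleftrightarrow> Z \<subseteq> K"
    using a_coset_join1[OF _ _ additive_subgroup.a_subgroup[OF assms(2)]] a_coset_join2[OF _ additive_subgroup.a_subgroup[OF assms(2)]] assms(3) by blast
  finally show ?thesis .
qed

text \<open>Reduces vanishing of cohomology to a statement about homomorphisms that need not be
  extensional, so that they may be composed and added freely.\<close>

lemma zero_hom_cohomology_Suc_iff:
  fixes X :: "nat \<Rightarrow> 'x set"
  assumes "module R N" and d: "\<And>n. d n \<in> mod_hom R (free_module R (X (Suc n))) (free_module R (X n))"
  shows "zero_module (hom_cohomology R N X d (Suc n)) \<longleftrightarrow>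
    (\<forall>\<phi>\<in>mod_hom R (free_module R (X (Suc n))) N.
      (\<forall>v\<in>carrier (free_module R (X (Suc (Suc n)))). \<phi> (d (Suc n) v) = \<zero>\<^bsub>N\<^esub>) \<longrightarrow>
      (\<exists>\<psi>\<in>mod_hom R (free_module R (X n)) N.
        \<forall>v\<in>carrier (free_module R (X (Suc n))). \<phi> v = \<psi> (d n v)))"
    (is "_ \<longleftrightarrow> (\<forall>\<phi>\<in>mod_hom R (?F (Suc n)) N. ?cocycle \<phi> \<longrightarrow> ?coboundary \<phi>)")
proof -
  interpret N: module R N by fact
  let ?F = "\<lambda>n. free_module R (X n)"
  let ?H = "Hom_module R (?F (Suc n)) N"
  let ?Z = "hom_cocycles R N X d (Suc n)" and ?B = "hom_coboundaries R N X d (Suc n)"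
  have F: "module R (?F n)" for n
    by (rule module_free_module) (rule N.R.is_cring)
  interpret F: module R "?F (Suc n)" by (rule F)
  have H: "module R (Hom_module R (?F n) N)" for n
    by (rule module_Hom_module[OF F assms(1)])
  interpret H: module R ?H by (rule H)
  have sub: "additive_subgroup ?B ?H"
    using additive_subgroup_mod_hom_image[OF H H precompose_mod_hom[OF F d]] by simp
  have Z: "\<phi> \<in> ?Z \<longleftrightarrow> \<phi> \<in> mod_hom R (?F (Suc n)) N \<inter> extensional (carrier (?F (Suc n))) \<and> ?cocycle \<phi>" for \<phi>
    by (auto simp: hom_cocycles_def Hom_module_def compose_def fun_eq_iff restrict_def)
  have B: "\<phi> \<in> ?B \<longleftrightarrow> ?coboundary \<phi>" if "\<phi> \<in> extensional (carrier (?F (Suc n)))" for \<phi>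
  proof
    assume "\<phi> \<in> ?B"
    then show "?coboundary \<phi>" by (auto simp: Hom_module_def compose_def)
  next
    assume "?coboundary \<phi>"
    then obtain \<psi> where \<psi>: "\<psi> \<in> mod_hom R (?F n) N" "\<And>v. v \<in> carrier (?F (Suc n)) \<Longrightarrow> \<phi> v = \<psi> (d n v)"
      by blast
    have "\<phi> = compose (carrier (?F (Suc n))) (restrict \<psi> (carrier (?F n))) (d n)"
      using \<psi>(2) that mod_hom_closed[OF d] by (auto simp: compose_def fun_eq_iff extensional_def)
    moreover have "restrict \<psi> (carrier (?F n)) \<in> carrier (Hom_module R (?F n) N)"
      using mod_hom_restrict[OF F \<psi>(1)] by (simp add: Hom_module_def)
    ultimately show "\<phi> \<in> ?B" by auto
  qed
  have "\<zero>\<^bsub>?H\<^esub> \<in> mod_hom R (?F (Suc n)) N \<inter> extensional (carrier (?F (Suc n)))"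
    using H.M.zero_closed by (simp add: Hom_module_def)
  moreover have "\<zero>\<^bsub>?H\<^esub> v = \<zero>\<^bsub>N\<^esub>" if "v \<in> carrier (?F (Suc n))" for v
    using that by (simp add: Hom_module_def)
  ultimately have "\<zero>\<^bsub>?H\<^esub> \<in> ?Z"
    using mod_hom_closed[OF d] by (simp add: Z)
  then have "zero_module (hom_cohomology R N X d (Suc n)) \<longleftrightarrow> ?Z \<subseteq> ?B"
    unfolding hom_cohomology_def
    by (intro zero_quotient_module_iff[OF H.M.abelian_group_axioms sub])
      (auto simp: hom_cocycles_def)
  also have "\<dots> \<longleftrightarrow> (\<forall>\<phi>\<in>mod_hom R (?F (Suc n)) N. ?cocycle \<phi> \<longrightarrow> ?coboundary \<phi>)"
  proof (intro iffI ballI impI subsetI)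
    fix \<phi> assume ZB: "?Z \<subseteq> ?B" and \<phi>: "\<phi> \<in> mod_hom R (?F (Suc n)) N" "?cocycle \<phi>"
    let ?r = "restrict \<phi> (carrier (?F (Suc n)))"
    have "?r \<in> ?Z"
      using \<phi> mod_hom_restrict[OF F \<phi>(1)] mod_hom_closed[OF d] by (auto simp: Z)
    then have "?coboundary ?r"
      using ZB B[of ?r] by auto
    then show "?coboundary \<phi>" by simp
  qed (use B in \<open>auto simp: Z simp del: hom_coboundaries.simps\<close>)
  finally show ?thesis .
qed

text \<open>
  The hypothesis on \<open>b\<close>, \<open>a\<close>, \<open>w\<close>, \<open>m\<close> says that the identity of \<open>M\<close> is a map through \<open>N\<close> plus a
  map through \<open>R\<close>. Lift \<open>a\<close> and \<open>b\<close> to chain maps \<open>P\<close> and \<open>I\<close>. The map through \<open>R\<close> lifts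
  to a chain map \<open>Q\<close> concentrated in degree zero, because \<open>R\<close> is its own resolution. Then
  \<open>id - I P - Q\<close> covers zero, so it has a null-homotopy \<open>s\<close>. A cocycle \<open>\<phi>\<close> of positive
  degree thus equals \<open>\<phi> I P + \<phi> s d\<close>, and \<open>\<phi> I\<close> is a coboundary by assumption.
\<close>

lemma cohomology_vanishing_retract:
  fixes X :: "nat \<Rightarrow> 'x set" and Y :: "nat \<Rightarrow> 'y set"
  assumes "module R M" "module R N" "module R L"
    and resX: "free_resolution R M X e d" and resY: "free_resolution R N Y e' d'"
    and a: "a \<in> mod_hom R M N" and b: "b \<in> mod_hom R N M"
    and w: "w \<in> mod_hom R M (ring_module R)" and m: "m \<in> carrier M"
    and split: "\<And>x. x \<in> carrier M \<Longrightarrow> x = b (a x) \<oplus>\<^bsub>M\<^esub> w x \<odot>\<^bsub>M\<^esub> m"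
    and zero: "zero_module (hom_cohomology R L Y d' (Suc n))"
  shows "zero_module (hom_cohomology R L X d (Suc n))"
proof -
  interpret M: module R M by fact
  interpret L: module R L by fact
  let ?F = "\<lambda>n. free_module R (X n)" and ?G = "\<lambda>n. free_module R (Y n)"
  have F: "module R (?F n)" and G: "module R (?G n)" for n
    by (rule module_free_module, rule M.R.is_cring)+
  interpret F: module R "?F j" for j by (rule F)
  note X = free_resolutionD[OF resX] and Y = free_resolutionD[OF resY]
  obtain P where P: "\<And>n. P n \<in> mod_hom R (?F n) (?G n)"
    "\<And>v. v \<in> carrier (?F 0) \<Longrightarrow> e' (P 0 v) = a (e v)"
    "\<And>n v. v \<in> carrier (?F (Suc n)) \<Longrightarrow> d' n (P (Suc n) v) = P n (d n v)"
    using chain_map_lift[OF assms(1,2) resX resY a] by blast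
  obtain I where I: "\<And>n. I n \<in> mod_hom R (?G n) (?F n)"
    "\<And>v. v \<in> carrier (?G 0) \<Longrightarrow> e (I 0 v) = b (e' v)"
    "\<And>n v. v \<in> carrier (?G (Suc n)) \<Longrightarrow> d n (I (Suc n) v) = I n (d' n v)"
    using chain_map_lift[OF assms(2,1) resY resX b] by blast
  note Pc = mod_hom_closed[OF P(1)] and Ic = mod_hom_closed[OF I(1)]
    and dc = mod_hom_closed[OF X(2)] and ec = mod_hom_closed[OF X(1)]
  have wc: "w x \<in> carrier R" if "x \<in> carrier M" for x
    using mod_hom_closed[OF w that] by (simp add: ring_module_def)
  obtain z where z: "z \<in> carrier (?F 0)" "e z = m"
    using m X(3) by (metis imageE)
  define Q where "Q v = w (e v) \<odot>\<^bsub>?F 0\<^esub> z" for v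
  have Q: "Q \<in> mod_hom R (?F 0) (?F 0)"
    unfolding Q_def using z(1) ec wc mod_hom_add[OF X(1)] mod_hom_smult[OF X(1)]
      mod_hom_add[OF w] mod_hom_smult[OF w]
    by (intro mod_homI) (auto simp: ring_module_def F.smult_l_distr F.smult_assoc1)
  have w0: "w \<zero>\<^bsub>M\<^esub> = \<zero>\<^bsub>R\<^esub>"
    using mod_hom_smult[OF w, of "\<zero>\<^bsub>R\<^esub>" "\<zero>\<^bsub>M\<^esub>"] wc[of "\<zero>\<^bsub>M\<^esub>"] by (simp add: ring_module_def)
  define J where "J n v = (case n of 0 \<Rightarrow> I 0 (P 0 v) \<oplus>\<^bsub>?F 0\<^esub> Q v | Suc k \<Rightarrow> I n (P n v))" for n v
  have J: "J n \<in> mod_hom R (?F n) (?F n)" for n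
    by (cases n) (auto simp: J_def[abs_def] intro!: mod_hom_add_hom[OF F] mod_hom_compose[OF P(1) I(1)] Q)
  define T where "T n v = v \<ominus>\<^bsub>?F n\<^esub> J n v" for n v
  have T: "T n \<in> mod_hom R (?F n) (?F n)" for n
    unfolding T_def[abs_def] by (intro mod_hom_diff_hom[OF F] mod_hom_id J)
  note Jc = mod_hom_closed[OF J]
  have T0: "e (T 0 v) = \<zero>\<^bsub>M\<^esub>" if v: "v \<in> carrier (?F 0)" for v
  proof -
    have "e (J 0 v) = b (a (e v)) \<oplus>\<^bsub>M\<^esub> w (e v) \<odot>\<^bsub>M\<^esub> m"
      using v Pc Ic mod_hom_closed[OF Q] ec wc z
      by (simp add: J_def mod_hom_add[OF X(1)] I(2) P(2) Q_def mod_hom_smult[OF X(1)])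
    then have "e (J 0 v) = e v"
      using split[OF ec[OF v]] by simp
    then have "e (T 0 v) = e v \<ominus>\<^bsub>M\<^esub> e v"
      using v Jc by (simp add: T_def mod_hom_diff[OF F assms(1) X(1)])
    then show ?thesis
      using ec[OF v] by (simp add: a_minus_def M.M.r_neg)
  qed
  have dJ: "d k (J (Suc k) v) = J k (d k v)" if v: "v \<in> carrier (?F (Suc k))" for k v
  proof (cases k)
    case 0
    have "Q (d 0 v) = \<zero>\<^bsub>?F 0\<^esub>"
      using v z X(5) by (simp add: Q_def 0 w0)
    then show ?thesis
      using v Pc Ic dc by (simp add: J_def 0 I(3) P(3))
  next
    case (Suc j)
    then show ?thesis
      using v Pc by (simp add: J_def I(3) P(3))
  qed
  have dT: "d k (T (Suc k) v) = T k (d k v)" if "v \<in> carrier (?F (Suc k))" for k v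
    using that Jc by (simp add: T_def mod_hom_diff[OF F F X(2)] dJ)
  obtain s where s: "\<And>n. s n \<in> mod_hom R (?F n) (?F (Suc n))"
    "\<And>n v. v \<in> carrier (?F (Suc n)) \<Longrightarrow>
      T (Suc n) v = d (Suc n) (s (Suc n) v) \<oplus>\<^bsub>?F (Suc n)\<^esub> s n (d n v)"
    using null_homotopy[where T = T and X = X and d = d and Y = X and d' = d, OF assms(1) resX resX T T0 dT] by blast
  note sc = mod_hom_closed[OF s(1)]
  show ?thesis
    unfolding zero_hom_cohomology_Suc_iff[where d = d and X = X, OF assms(3) X(2)]
  proof (intro ballI impI)
    fix \<phi> assume \<phi>: "\<phi> \<in> mod_hom R (?F (Suc n)) L"
      and cocycle: "\<forall>v\<in>carrier (?F (Suc (Suc n))). \<phi> (d (Suc n) v) = \<zero>\<^bsub>L\<^esub>"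
    have "\<forall>v\<in>carrier (?G (Suc (Suc n))). \<phi> (I (Suc n) (d' (Suc n) v)) = \<zero>\<^bsub>L\<^esub>"
      using cocycle Ic by (simp flip: I(3))
    then obtain \<psi> where \<psi>: "\<psi> \<in> mod_hom R (?G n) L"
      "\<And>v. v \<in> carrier (?G (Suc n)) \<Longrightarrow> \<phi> (I (Suc n) v) = \<psi> (d' n v)"
      using bspec[OF iffD1[OF zero_hom_cohomology_Suc_iff[where d = d' and X = Y, OF assms(3) Y(2)] zero],
          OF mod_hom_compose[OF I(1) \<phi>]] by blast
    have "\<phi> v = \<phi> (s n (d n v)) \<oplus>\<^bsub>L\<^esub> \<psi> (P n (d n v))" if v: "v \<in> carrier (?F (Suc n))" for v
    proof -
      have c: "d (Suc n) (s (Suc n) v) \<in> carrier (?F (Suc n))" "s n (d n v) \<in> carrier (?F (Suc n))"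
        "I (Suc n) (P (Suc n) v) \<in> carrier (?F (Suc n))"
        using v sc dc Ic Pc by auto
      have "v = T (Suc n) v \<oplus>\<^bsub>?F (Suc n)\<^esub> I (Suc n) (P (Suc n) v)"
        using v c by (simp add: T_def J_def a_minus_def F.M.a_assoc F.M.l_neg)
      then have "\<phi> v = \<phi> (d (Suc n) (s (Suc n) v)) \<oplus>\<^bsub>L\<^esub> \<phi> (s n (d n v)) \<oplus>\<^bsub>L\<^esub> \<phi> (I (Suc n) (P (Suc n) v))"
        using c s(2)[OF v] by (metis F.M.a_closed mod_hom_add[OF \<phi>])
      then show ?thesis
        using cocycle v sc Pc c(2) mod_hom_closed[OF \<phi>] by (simp add: \<psi>(2) P(3))
    qed
    then show "\<exists>\<psi>\<in>mod_hom R (?F n) L. \<forall>v\<in>carrier (?F (Suc n)). \<phi> v = \<psi> (d n v)"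
      using mod_hom_add_hom[OF assms(3) mod_hom_compose[OF s(1) \<phi>] mod_hom_compose[OF P(1) \<psi>(1)]]
      by (intro bexI[of _ "\<lambda>u. \<phi> (s n u) \<oplus>\<^bsub>L\<^esub> \<psi> (P n u)"]) auto
  qed
qed

lemma Ext_from_resolution:
  fixes R :: "('r, 'a) ring_scheme" and M :: "('r, 'm, 'b) module_scheme"
  assumes "module R M"
  obtains X :: "nat \<Rightarrow> ('r, 'm) res_index set" and e d
  where "free_resolution R M X e d" "\<And>i. Ext R M N i = hom_cohomology R N X d i"
proof -
  let ?P = "\<lambda>(X :: nat \<Rightarrow> ('r, 'm) res_index set, e, d). free_resolution R M X e d"
  obtain X e d where Xed: "(SOME t. ?P t) = (X, e, d)" by (metis prod.exhaust)
  have "\<exists>t. ?P t" using free_resolution_exists[OF assms] by auto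
  from someI_ex[OF this] have "free_resolution R M X e d" unfolding Xed by simp
  moreover have "Ext R M N i = hom_cohomology R N X d i" for i
    using Xed by (simp add: Ext_def)
  ultimately show thesis using that by blast
qed

text \<open>Since the preceding comparison relates arbitrary resolutions of the two modules, it
  applies to the ones chosen in the definition of \<open>Ext\<close>.\<close>

lemma Ext_vanishing_retract:
  assumes "module R M" "module R N" "module R L"
    and "a \<in> mod_hom R M N" "b \<in> mod_hom R N M"
    and "w \<in> mod_hom R M (ring_module R)" "m \<in> carrier M"
    and "\<And>x. x \<in> carrier M \<Longrightarrow> x = b (a x) \<oplus>\<^bsub>M\<^esub> w x \<odot>\<^bsub>M\<^esub> m"
    and "i \<ge> 1" "zero_module (Ext R N L i)"
  shows "zero_module (Ext R M L i)"
proof -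
  obtain n where n: "i = Suc n" using assms(9) by (cases i) auto
  obtain X e d where X: "free_resolution R M X e d" "\<And>i. Ext R M L i = hom_cohomology R L X d i"
    by (rule Ext_from_resolution[OF assms(1), where N = L]) blast
  obtain Y e' d' where Y: "free_resolution R N Y e' d'" "\<And>i. Ext R N L i = hom_cohomology R L Y d' i"
    by (rule Ext_from_resolution[OF assms(2), where N = L]) blast
  have "zero_module (hom_cohomology R L Y d' (Suc n))"
    using assms(10) unfolding n Y(2) .
  from cohomology_vanishing_retract[OF assms(1-3) X(1) Y(1) assms(4-8) this]
  show ?thesis unfolding n X(2) .
qed


section \<open>Quadratic covers\<close>

text \<open>
  The subring \<open>R + C t\<close> of \<open>R[t]/(t\<^sup>2 - k t - h)\<close>, where the pair \<open>(a, b)\<close> stands for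
  \<open>a + b t\<close>. The multiplication is prescribed on the carrier only, so that both rings of the
  theorem are instances whatever their products are elsewhere.
\<close>

locale quadratic_cover = cring R + C: ideal C R + S: cring S
  for R :: "('r, 'a) ring_scheme" (structure) and C and S :: "('r \<times> 'r, 'b) ring_scheme" and k h +
  assumes coeffs [simp]: "k \<in> carrier R" "h \<in> carrier R"
    and carrier_S: "carrier S = carrier R \<times> C"
    and add_S: "\<And>a b a' b'. (a, b) \<oplus>\<^bsub>S\<^esub> (a', b') = (a \<oplus> a', b \<oplus> b')"
    and mult_S: "\<And>a b a' b'. a \<in> carrier R \<Longrightarrow> b \<in> C \<Longrightarrow> a' \<in> carrier R \<Longrightarrow> b' \<in> C \<Longrightarrow>
      (a, b) \<otimes>\<^bsub>S\<^esub> (a', b') = (a \<otimes> a' \<oplus> h \<otimes> (b \<otimes> b'), a \<otimes> b' \<oplus> a' \<otimes> b \<oplus> k \<otimes> (b \<otimes> b'))"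
    and zero_S: "\<zero>\<^bsub>S\<^esub> = (\<zero>, \<zero>)" and one_S: "\<one>\<^bsub>S\<^esub> = (\<one>, \<zero>)"
begin

lemma C_in_R [simp]: "c \<in> C \<Longrightarrow> c \<in> carrier R"
  using C.a_subset by auto

lemmas C_simps [simp] = C.a_closed C.I_l_closed C.I_r_closed C.a_inv_closed

lemmas S_simps = carrier_S add_S mult_S zero_S one_S

definition embed :: "'r \<Rightarrow> 'r \<times> 'r"
  where "embed r = (r, \<zero>)"

lemma embed_ring_hom: "embed \<in> ring_hom R S"
  by (rule ring_hom_memI) (simp_all add: embed_def S_simps)

abbreviation S_mod :: "('r, 'r \<times> 'r) module"
  where "S_mod \<equiv> module_via S embed"

abbreviation C_mod :: "('r, 'r) module"
  where "C_mod \<equiv> ideal_module R C"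

lemma C_mod_simps:
  "carrier C_mod = C" "add C_mod = (\<oplus>)" "smult C_mod = (\<otimes>)" "zero C_mod = \<zero>"
  by (simp_all add: ideal_module_def ring_module_def)

lemma S_mod_simps:
  "carrier S_mod = carrier R \<times> C" "add S_mod = add S" "zero S_mod = (\<zero>, \<zero>)"
  by (simp_all add: module_via_def S_simps)

lemma smult_S_mod:
  "r \<in> carrier R \<Longrightarrow> a \<in> carrier R \<Longrightarrow> c \<in> C \<Longrightarrow> r \<odot>\<^bsub>S_mod\<^esub> (a, c) = (r \<otimes> a, r \<otimes> c)"
  by (simp add: module_via_def embed_def S_simps)

lemma module_S: "module R S_mod"
  using S.cring_axioms
proof (intro moduleI abelian_groupI, goal_cases)
  case (7 x)
  then show ?case
    by (intro bexI[of _ "\<ominus>\<^bsub>S\<^esub> x"]) (auto simp: module_via_def S.l_neg)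
qed (auto simp: S_mod_simps add_S smult_S_mod a_ac l_distr r_distr m_assoc
    is_cring module_via_def embed_def one_S S_simps)

lemma module_C: "module R C_mod"
proof (intro moduleI abelian_groupI, goal_cases)
  case (7 x)
  then show ?case
    by (intro bexI[of _ "\<ominus> x"]) (auto simp: C_mod_simps l_neg)
qed (auto simp: C_mod_simps a_ac l_distr r_distr m_assoc is_cring)

context
  fixes r0
  assumes root: "r0 \<in> carrier R" "r0 \<otimes> r0 = k \<otimes> r0 \<oplus> h"
begin

text \<open>Substitution of the root \<open>r0\<close> for \<open>t\<close>.\<close>

definition specialize :: "'r \<times> 'r \<Rightarrow> 'r"
  where "specialize s = fst s \<oplus> r0 \<otimes> snd s"

lemma specialize_ring_hom: "specialize \<in> ring_hom S R"
proof (rule ring_hom_memI)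
  note [simp] = root(1)
  fix x y assume "x \<in> carrier S" "y \<in> carrier S"
  then obtain a b a' b' where xy: "x = (a, b)" "y = (a', b')"
    and [simp]: "a \<in> carrier R" "b \<in> C" "a' \<in> carrier R" "b' \<in> C"
    by (auto simp: S_simps)
  show "specialize (x \<oplus>\<^bsub>S\<^esub> y) = specialize x \<oplus> specialize y"
    by (simp add: xy specialize_def S_simps r_distr a_ac)
  have "specialize x \<otimes> specialize y =
    a \<otimes> a' \<oplus> r0 \<otimes> (a \<otimes> b' \<oplus> a' \<otimes> b) \<oplus> (r0 \<otimes> r0) \<otimes> (b \<otimes> b')"
    by (simp add: xy specialize_def l_distr r_distr a_ac m_ac)
  also have "\<dots> = specialize (x \<otimes>\<^bsub>S\<^esub> y)"
    by (simp add: root(2)) (simp add: xy specialize_def S_simps l_distr r_distr a_ac m_ac)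
  finally show "specialize (x \<otimes>\<^bsub>S\<^esub> y) = specialize x \<otimes> specialize y" by simp
qed (use root in \<open>auto simp: specialize_def S_simps\<close>)

lemma specialize_embed: "r \<in> carrier R \<Longrightarrow> specialize (embed r) = r"
  using root(1) by (simp add: specialize_def embed_def)

lemma C_iso_kernel:
  "mod_isomorphic R C_mod (S_mod\<lparr>carrier := a_kernel S R specialize\<rparr>)"
proof -
  note [simp] = root(1)
  let ?h = "\<lambda>c. (\<ominus> (r0 \<otimes> c), c)"
  have ker: "a_kernel S R specialize = {s \<in> carrier R \<times> C. fst s \<oplus> r0 \<otimes> snd s = \<zero>}"
    by (auto simp: a_kernel_def kernel_def specialize_def carrier_S)
  have "?h \<in> mod_hom R C_mod (S_mod\<lparr>carrier := a_kernel S R specialize\<rparr>)"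
    by (rule mod_homI)
      (auto simp: C_mod_simps ker S_mod_simps add_S smult_S_mod l_neg r_distr minus_add r_minus m_lcomm)
  moreover have "bij_betw ?h C (a_kernel S R specialize)"
    by (rule bij_betw_byWitness[of _ snd])
      (auto simp: ker l_neg intro: minus_equality)
  ultimately show ?thesis
    by (auto simp: mod_isomorphic_def C_mod_simps)
qed

end

text \<open>The pairing \<open>S \<times> S \<rightarrow> C\<close> that identifies \<open>S\<close> with \<open>Hom\<^sub>R(S, C)\<close>. The functional attached
  to \<open>(x, y)\<close> takes the value \<open>y\<close> at \<open>1\<close> and is multiplication by \<open>x + k y\<close> on \<open>C t\<close>, so it
  determines both coordinates once multipliers of \<open>C\<close> are unique.\<close>

lemma snd_mult:
  assumes "x \<in> carrier R" "y \<in> C" "r \<in> carrier R" "c \<in> C"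
  shows "snd ((x, y) \<otimes>\<^bsub>S\<^esub> (r, c)) = (x \<oplus> k \<otimes> y) \<otimes> c \<oplus> r \<otimes> y"
  using assms by (simp add: mult_S l_distr a_ac m_assoc)

lemma snd_mod_hom: "snd \<in> mod_hom R S_mod C_mod"
  by (rule mod_homI) (auto simp: C_mod_simps S_mod_simps add_S smult_S_mod)

lemma Hom_iso_S:
  assumes iso: "mod_isomorphic R (ring_module R) (Hom_module R C_mod C_mod)"
  shows "mod_isomorphic S (coinduced_module R S embed C_mod) (ring_module S)"
proof (rule mod_isomorphic_sym)
  show "module S (ring_module S)"
    by (rule module_ring_module) (rule S.is_cring)
  let ?H = "coinduced_module R S embed C_mod"
  let ?\<theta> = "\<lambda>s. \<lambda>t\<in>carrier S. snd (s \<otimes>\<^bsub>S\<^esub> t)"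
  have H: "carrier ?H = mod_hom R S_mod C_mod \<inter> extensional (carrier S)"
    by (simp add: coinduced_module_def Hom_module_def Let_def module_via_def)
  have \<theta>: "?\<theta> s \<in> carrier ?H" if s: "s \<in> carrier S" for s
  proof -
    have "(\<lambda>t. s \<otimes>\<^bsub>S\<^esub> t) \<in> mod_hom R S_mod S_mod"
      using s ring_hom_closed[OF embed_ring_hom]
      by (intro mod_homI) (auto simp: module_via_def S.r_distr S.m_lcomm)
    from mod_hom_restrict[OF module_S mod_hom_compose[OF this snd_mod_hom]]
    show ?thesis by (simp add: H) (simp add: module_via_def)
  qed
  have "?\<theta> \<in> mod_hom S (ring_module S) ?H"
  proof (rule mod_homI)
    fix s assume "s \<in> carrier (ring_module S)"
    then show "?\<theta> s \<in> carrier ?H" using \<theta> by (simp add: ring_module_def)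
  next
    fix s s' assume "s \<in> carrier (ring_module S)" "s' \<in> carrier (ring_module S)"
    then have s: "s \<in> carrier S" "s' \<in> carrier S" by (simp_all add: ring_module_def)
    have "snd ((s \<oplus>\<^bsub>S\<^esub> s') \<otimes>\<^bsub>S\<^esub> t) = snd (s \<otimes>\<^bsub>S\<^esub> t) \<oplus> snd (s' \<otimes>\<^bsub>S\<^esub> t)" if "t \<in> carrier S" for t
      using s that by (simp add: S.l_distr) (metis add_S prod.collapse snd_conv)
    then show "?\<theta> (s \<oplus>\<^bsub>ring_module S\<^esub> s') = ?\<theta> s \<oplus>\<^bsub>?H\<^esub> ?\<theta> s'"
      by (auto simp: ring_module_def coinduced_module_def Hom_module_def Let_def module_via_def
          C_mod_simps)
  next
    fix a s assume "a \<in> carrier S" "s \<in> carrier (ring_module S)"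
    then have s: "a \<in> carrier S" "s \<in> carrier S" by (simp_all add: ring_module_def)
    then show "?\<theta> (a \<odot>\<^bsub>ring_module S\<^esub> s) = a \<odot>\<^bsub>?H\<^esub> ?\<theta> s"
      by (auto simp: ring_module_def coinduced_module_def Let_def S.m_ac)
  qed
  moreover have "bij_betw ?\<theta> (carrier S) (carrier ?H)"
    unfolding bij_betw_def
  proof
    show "inj_on ?\<theta> (carrier S)"
    proof (rule inj_onI)
      fix s s' assume s: "s \<in> carrier S" "s' \<in> carrier S" and eq: "?\<theta> s = ?\<theta> s'"
      then obtain x y x' y' where xy: "s = (x, y)" "s' = (x', y')"
        and [simp]: "x \<in> carrier R" "y \<in> C" "x' \<in> carrier R" "y' \<in> C"
        by (auto simp: carrier_S)
      have eq': "(x \<oplus> k \<otimes> y) \<otimes> c \<oplus> r \<otimes> y = (x' \<oplus> k \<otimes> y') \<otimes> c \<oplus> r \<otimes> y'"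
        if "r \<in> carrier R" "c \<in> C" for r c
        using fun_cong[OF eq, of "(r, c)"] that by (simp add: carrier_S xy snd_mult)
      have y: "y = y'"
        using eq'[of \<one> \<zero>] by simp
      have "x \<oplus> k \<otimes> y = x' \<oplus> k \<otimes> y'"
      proof (rule homothety_faithful[OF module_C iso])
        fix c assume "c \<in> carrier C_mod"
        then show "(x \<oplus> k \<otimes> y) \<odot>\<^bsub>C_mod\<^esub> c = (x' \<oplus> k \<otimes> y') \<odot>\<^bsub>C_mod\<^esub> c"
          using eq'[of \<zero> c] by (simp add: C_mod_simps)
      qed simp_all
      then show "s = s'" using y by (simp add: xy)
    qed
    show "?\<theta> ` carrier S = carrier ?H"
    proof (intro equalityI subsetI)
      fix \<phi> assume "\<phi> \<in> carrier ?H"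
      then have \<phi>: "\<phi> \<in> mod_hom R S_mod C_mod" and ext: "\<phi> \<in> extensional (carrier S)"
        by (simp_all add: H)
      define y where "y = \<phi> (\<one>, \<zero>)"
      have y [simp]: "y \<in> C"
        using mod_hom_closed[OF \<phi>, of "(\<one>, \<zero>)"] by (simp add: y_def S_mod_simps C_mod_simps)
      have "(\<lambda>c. (\<zero>, c)) \<in> mod_hom R C_mod S_mod"
        by (rule mod_homI) (auto simp: C_mod_simps S_mod_simps add_S smult_S_mod)
      from endomorphism_is_homothety[OF module_C iso mod_hom_compose[OF this \<phi>]]
      obtain z where z [simp]: "z \<in> carrier R" and \<phi>z: "\<And>c. c \<in> C \<Longrightarrow> \<phi> (\<zero>, c) = z \<otimes> c"
        by (auto simp: C_mod_simps)
      have zky: "(z \<ominus> k \<otimes> y) \<oplus> k \<otimes> y = z"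
        by (simp add: a_minus_def a_assoc l_neg)
      have "\<phi> t = ?\<theta> (z \<ominus> k \<otimes> y, y) t" for t
      proof (cases "t \<in> carrier S")
        case True
        then obtain r c where t: "t = (r, c)" and [simp]: "r \<in> carrier R" "c \<in> C"
          by (auto simp: carrier_S)
        have "t = r \<odot>\<^bsub>S_mod\<^esub> (\<one>, \<zero>) \<oplus>\<^bsub>S_mod\<^esub> (\<zero>, c)"
          by (simp add: t smult_S_mod S_mod_simps add_S)
        then have "\<phi> t = r \<otimes> y \<oplus> z \<otimes> c"
          using mod_hom_add[OF \<phi>, of "r \<odot>\<^bsub>S_mod\<^esub> (\<one>, \<zero>)" "(\<zero>, c)"]
            mod_hom_smult[OF \<phi>, of r "(\<one>, \<zero>)"]
          by (simp add: smult_S_mod S_mod_simps C_mod_simps \<phi>z y_def)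
        also have "\<dots> = ?\<theta> (z \<ominus> k \<otimes> y, y) t"
          using True by (simp add: t snd_mult zky a_comm)
        finally show ?thesis .
      next
        case False
        then show ?thesis using extensional_arb[OF ext False] by simp
      qed
      then show "\<phi> \<in> ?\<theta> ` carrier S"
        by (intro image_eqI[of _ _ "(z \<ominus> k \<otimes> y, y)"]) (auto simp: carrier_S)
    qed (use \<theta> in auto)
  qed
  ultimately show "mod_isomorphic S (ring_module S) ?H"
    by (auto simp: mod_isomorphic_def ring_module_def)
qed

lemma Ext_S_vanishes:
  assumes "\<And>i. i \<ge> 1 \<Longrightarrow> zero_module (Ext R C_mod C_mod i)" "i \<ge> 1"
  shows "zero_module (Ext R S_mod C_mod i)"
proof (rule Ext_vanishing_retract[OF module_S module_C module_C snd_mod_hom])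
  show "(\<lambda>c. (\<zero>, c)) \<in> mod_hom R C_mod S_mod"
    by (rule mod_homI) (auto simp: C_mod_simps S_mod_simps add_S smult_S_mod)
  show "fst \<in> mod_hom R S_mod (ring_module R)"
    by (rule mod_homI) (auto simp: ring_module_def S_mod_simps add_S smult_S_mod)
  show "(\<one>, \<zero>) \<in> carrier S_mod"
    by (simp add: S_mod_simps)
  show "x = (\<zero>, snd x) \<oplus>\<^bsub>S_mod\<^esub> fst x \<odot>\<^bsub>S_mod\<^esub> (\<one>, \<zero>)" if "x \<in> carrier S_mod" for x
    using that by (auto simp: S_mod_simps smult_S_mod add_S)
qed (use assms in auto)

lemma semidualizing_quadratic_cover:
  assumes "r0 \<in> carrier R" "r0 \<otimes> r0 = k \<otimes> r0 \<oplus> h" and semi: "semidualizing R C_mod"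
  shows "\<exists>f\<in>ring_hom R S. \<exists>g\<in>ring_hom S R.
    (\<forall>r\<in>carrier R. g (f r) = r) \<and>
    mod_isomorphic R C_mod ((module_via S f)\<lparr>carrier := a_kernel S R g\<rparr>) \<and>
    mod_isomorphic S (coinduced_module R S f C_mod) (ring_module S) \<and>
    (\<forall>i\<ge>1. zero_module (Ext R (module_via S f) C_mod i))"
  using embed_ring_hom specialize_ring_hom[OF assms(1,2)] specialize_embed[OF assms(1,2)]
    C_iso_kernel[OF assms(1,2)] Hom_iso_S Ext_S_vanishes semi
  unfolding semidualizing_def by blast

end

section \<open>Amalgamated duplications and pseudocanonical covers\<close>

lemma quadratic_cover_amalgamated_duplication:
  assumes "cring R" "ideal C R"
  shows "quadratic_cover R C (amalgamated_duplication R C) \<one>\<^bsub>R\<^esub> \<zero>\<^bsub>R\<^esub>"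
proof -
  interpret cring R by fact
  interpret C: ideal C R by fact
  have [simp]: "c \<in> carrier R" if "c \<in> C" for c
    using that C.a_subset by auto
  show ?thesis
    by (intro quadratic_cover.intro quadratic_cover_axioms.intro assms
        cring_amalgamated_duplication)
      (auto simp: amalgamated_duplication_def)
qed

lemma quadratic_cover_pseudocanonical_cover:
  assumes "cring R" "ideal C R" "h \<in> carrier R"
  shows "quadratic_cover R C (pseudocanonical_cover R C h) \<zero>\<^bsub>R\<^esub> h"
proof -
  interpret cring R by fact
  interpret C: ideal C R by fact
  have [simp]: "c \<in> carrier R" if "c \<in> C" for c
    using that C.a_subset by auto
  show ?thesis
    by (intro quadratic_cover.intro quadratic_cover_axioms.intro assms
        cring_pseudocanonical_cover)
      (use assms(3) in \<open>auto simp: pseudocanonical_cover_def m_comm\<close>)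
qed

theorem theorem3:
  fixes R :: "('r, 'a) ring_scheme" and C :: "'r set" and S :: "('r \<times> 'r) ring"
  assumes "cring R" and "noetherian_ring R"
    and "ideal C R" and "semidualizing R (ideal_module R C)"
    and "S = amalgamated_duplication R C \<or>
      (\<exists>h\<in>carrier R. (\<exists>r0\<in>carrier R. h = r0 \<otimes>\<^bsub>R\<^esub> r0) \<and> S = pseudocanonical_cover R C h)"
  shows "\<exists>f\<in>ring_hom R S. \<exists>g\<in>ring_hom S R.
    (\<forall>r\<in>carrier R. g (f r) = r) \<and>
    mod_isomorphic R (ideal_module R C) ((module_via S f)\<lparr>carrier := a_kernel S R g\<rparr>) \<and>
    mod_isomorphic S (coinduced_module R S f (ideal_module R C)) (ring_module S) \<and>
    (\<forall>i\<ge>1. zero_module (Ext R (module_via S f) (ideal_module R C) i))"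
  using assms(5)
proof (elim disjE bexE conjE)
  interpret cring R by fact
  \<comment> \<open>Here \<open>t\<^sup>2 = t\<close>, and \<open>0\<close> is a root.\<close>
  assume S: "S = amalgamated_duplication R C"
  show ?thesis
    unfolding S
    by (rule quadratic_cover.semidualizing_quadratic_cover
        [OF quadratic_cover_amalgamated_duplication[OF assms(1,3)] _ _ assms(4), of "\<zero>\<^bsub>R\<^esub>"]) simp_all
next
  interpret cring R by fact
  \<comment> \<open>Here \<open>t\<^sup>2 = h = r0\<^sup>2\<close>.\<close>
  fix h r0 assume h: "h \<in> carrier R" "r0 \<in> carrier R" "h = r0 \<otimes>\<^bsub>R\<^esub> r0"
    and S: "S = pseudocanonical_cover R C h"
  show ?thesis
    unfolding S
    by (rule quadratic_cover.semidualizing_quadratic_cover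
        [OF quadratic_cover_pseudocanonical_cover[OF assms(1,3) h(1)] h(2) _ assms(4)]) (use h in simp)
qed

end
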